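(* Let $A\in\mathbb{H}^{m\times n}$ have rank $r$, and let $M$ and $N$ be positive definite quaternion matrices of order $m$ and $n$, respectively. Then there exist $U\in\mathbb{H}^{m\times m}$ and $V\in\mathbb{H}^{n\times n}$ satisfying $U^{*}MU=I_{m}$ and $V^{*}N^{-1}V=I_{n}$ such that $$A=UDV^{*},\qquad D=\begin{pmatrix}\Sigma & 0\\ 0& 0\end{pmatrix}\in\mathbb{H}^{m\times n},$$ where $\Sigma=\mathrm{diag}(\sigma_1,\sigma_2,\dots,\sigma_r)$, $\sigma_1\ge\sigma_2\ge\dots\ge\sigma_r>0$, and $\sigma_1^2,\dots,\sigma_r^2$ are the nonzero eigenvalues of $A^{\sharp}A$ or of $AA^{\sharp}$, which coincide.
   Context: $\mathbb{H}$ is the skew field of real quaternions; $\mathbb{H}^{m\times n}$ is the set of $m\times n$ quaternion matrices; $A^{*}$ is the conjugate transpose. A matrix $P\in\mathbb{H}^{n\times n}$ is Hermitian if $P^{*}=P$, and positive definite if it is Hermitian and $x^{*}Px>0$ for every nonzero $x\in\mathbb{H}^{n}$. For given positive definite $M$ (order $m$) and $N$ (order $n$), $A^{\sharp}:=N^{-1}A^{*}M\in\mathbb{H}^{n\times m}$. Eigenvalues are right eigenvalues: $\lambda\in\mathbb{H}$ is a right eigenvalue of $B$ if $Bx=x\lambda$ for some nonzero column $x$; they are listed with multiplicity (for $A^\sharp A$ and $AA^\sharp$ they are real and nonnegative). *)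

theory Defs
  imports "Jordan_Normal_Form.Char_Poly"
begin

section \<open>The skew field of real quaternions\<close>

datatype quat = Quat (qre: real) (qim1: real) (qim2: real) (qim3: real)

lemma quat_eq_iff:
  "p = q \<longleftrightarrow> qre p = qre q \<and> qim1 p = qim1 q \<and> qim2 p = qim2 q \<and> qim3 p = qim3 q"
  by (cases p; cases q) auto

instantiation quat :: real_vector
begin

definition zero_quat :: quat where "0 = Quat 0 0 0 0"

definition plus_quat :: "quat \<Rightarrow> quat \<Rightarrow> quat" where
  "p + q = Quat (qre p + qre q) (qim1 p + qim1 q) (qim2 p + qim2 q) (qim3 p + qim3 q)"

definition uminus_quat :: "quat \<Rightarrow> quat" where
  "- p = Quat (- qre p) (- qim1 p) (- qim2 p) (- qim3 p)"

definition minus_quat :: "quat \<Rightarrow> quat \<Rightarrow> quat" where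
  "p - q = Quat (qre p - qre q) (qim1 p - qim1 q) (qim2 p - qim2 q) (qim3 p - qim3 q)"

definition scaleR_quat :: "real \<Rightarrow> quat \<Rightarrow> quat" where
  "scaleR t p = Quat (t * qre p) (t * qim1 p) (t * qim2 p) (t * qim3 p)"

instance
  by standard
    (simp_all add: quat_eq_iff zero_quat_def plus_quat_def uminus_quat_def minus_quat_def
      scaleR_quat_def algebra_simps)

end

lemma quat_sel_simps [simp]:
  "qre 0 = 0" "qim1 0 = 0" "qim2 0 = 0" "qim3 0 = 0"
  "qre (p + q) = qre p + qre q" "qim1 (p + q) = qim1 p + qim1 q"
  "qim2 (p + q) = qim2 p + qim2 q" "qim3 (p + q) = qim3 p + qim3 q"
  "qre (- p) = - qre p" "qim1 (- p) = - qim1 p" "qim2 (- p) = - qim2 p" "qim3 (- p) = - qim3 p"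
  "qre (p - q) = qre p - qre q" "qim1 (p - q) = qim1 p - qim1 q"
  "qim2 (p - q) = qim2 p - qim2 q" "qim3 (p - q) = qim3 p - qim3 q"
  "qre (t *\<^sub>R p) = t * qre p" "qim1 (t *\<^sub>R p) = t * qim1 p"
  "qim2 (t *\<^sub>R p) = t * qim2 p" "qim3 (t *\<^sub>R p) = t * qim3 p"
  by (simp_all add: zero_quat_def plus_quat_def uminus_quat_def minus_quat_def scaleR_quat_def)

definition qcnj :: "quat \<Rightarrow> quat" where
  "qcnj q = Quat (qre q) (- qim1 q) (- qim2 q) (- qim3 q)"

lemma qcnj_sel [simp]:
  "qre (qcnj q) = qre q" "qim1 (qcnj q) = - qim1 q"
  "qim2 (qcnj q) = - qim2 q" "qim3 (qcnj q) = - qim3 q"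
  by (simp_all add: qcnj_def)

definition qnorm_sq :: "quat \<Rightarrow> real" where
  "qnorm_sq q = (qre q)^2 + (qim1 q)^2 + (qim2 q)^2 + (qim3 q)^2"

lemma qnorm_sq_eq_0: "qnorm_sq q = 0 \<longleftrightarrow> q = 0"
  by (simp add: qnorm_sq_def quat_eq_iff add_nonneg_eq_0_iff)

instantiation quat :: real_div_algebra
begin

definition one_quat :: quat where "1 = Quat 1 0 0 0"

definition times_quat :: "quat \<Rightarrow> quat \<Rightarrow> quat" where
  "p * q = Quat
     (qre p * qre q - qim1 p * qim1 q - qim2 p * qim2 q - qim3 p * qim3 q)
     (qre p * qim1 q + qim1 p * qre q + qim2 p * qim3 q - qim3 p * qim2 q)
     (qre p * qim2 q - qim1 p * qim3 q + qim2 p * qre q + qim3 p * qim1 q)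
     (qre p * qim3 q + qim1 p * qim2 q - qim2 p * qim1 q + qim3 p * qre q)"

definition inverse_quat :: "quat \<Rightarrow> quat" where
  "inverse q = inverse (qnorm_sq q) *\<^sub>R qcnj q"

definition divide_quat :: "quat \<Rightarrow> quat \<Rightarrow> quat" where
  "divide_quat p q = p * inverse q"

instance
proof
  fix a b c :: quat and t :: real
  show "a * b * c = a * (b * c)"
    by (simp add: quat_eq_iff times_quat_def algebra_simps)
  show "(a + b) * c = a * c + b * c"
    by (simp add: quat_eq_iff times_quat_def algebra_simps)
  show "a * (b + c) = a * b + a * c"
    by (simp add: quat_eq_iff times_quat_def algebra_simps)
  show "1 * a = a" "a * 1 = a"
    by (simp_all add: quat_eq_iff times_quat_def one_quat_def)
  show "(0::quat) \<noteq> 1"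
    by (simp add: quat_eq_iff one_quat_def)
  show "t *\<^sub>R a * b = t *\<^sub>R (a * b)" "a * t *\<^sub>R b = t *\<^sub>R (a * b)"
    by (simp_all add: quat_eq_iff times_quat_def algebra_simps)
  show "a div b = a * inverse b"
    by (rule divide_quat_def)
  show "inverse (0::quat) = 0"
    by (simp add: inverse_quat_def quat_eq_iff)
  have cc: "a * qcnj a = qnorm_sq a *\<^sub>R 1" "qcnj a * a = qnorm_sq a *\<^sub>R 1"
    by (simp_all add: quat_eq_iff times_quat_def one_quat_def qnorm_sq_def power2_eq_square)
  have sc: "x * t *\<^sub>R y = t *\<^sub>R (x * y)" "t *\<^sub>R x * y = t *\<^sub>R (x * y)" for x y :: quat and t
    by (simp_all add: quat_eq_iff times_quat_def algebra_simps)
  assume "a \<noteq> 0"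
  then have "qnorm_sq a \<noteq> 0"
    by (simp add: qnorm_sq_eq_0)
  then show "inverse a * a = 1" "a * inverse a = 1"
    by (simp_all add: inverse_quat_def sc cc)
qed

end


section \<open>Quaternion matrices\<close>

text \<open>Column vectors form a right vector space, so scalars act on the right.\<close>

definition vec_smult_right :: "quat vec \<Rightarrow> quat \<Rightarrow> quat vec" (infixl "\<cdot>\<^sub>r" 70) where
  "x \<cdot>\<^sub>r c = map_vec (\<lambda>a. a * c) x"

definition adjoint_quat_mat :: "quat mat \<Rightarrow> quat mat" ("(_\<^sup>H)" [1000] 999) where
  "A\<^sup>H = map_mat qcnj (transpose_mat A)"

definition hermitian_quat_mat :: "quat mat \<Rightarrow> bool" where
  "hermitian_quat_mat P \<longleftrightarrow> P\<^sup>H = P"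

text \<open>There is no order on \<open>quat\<close>: positivity of the quaternion \<open>x\<^sup>* P x\<close> means that it is a
  positive real.\<close>

definition pos_def_quat_mat :: "nat \<Rightarrow> quat mat \<Rightarrow> bool" where
  "pos_def_quat_mat n P \<longleftrightarrow> P \<in> carrier_mat n n \<and> hermitian_quat_mat P \<and>
     (\<forall>x \<in> carrier_vec n. x \<noteq> 0\<^sub>v n \<longrightarrow>
        (\<exists>t>0. map_vec qcnj x \<bullet> (P *\<^sub>v x) = of_real t))"

text \<open>Total function; only meaningful when \<open>B\<close> is an invertible square matrix.\<close>

definition inv_quat_mat :: "quat mat \<Rightarrow> quat mat" where
  "inv_quat_mat B = (THE X. X \<in> carrier_mat (dim_row B) (dim_row B) \<and>
     inverts_mat B X \<and> inverts_mat X B)"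

definition weighted_adjoint :: "quat mat \<Rightarrow> quat mat \<Rightarrow> quat mat \<Rightarrow> quat mat" where
  "weighted_adjoint M N A = inv_quat_mat N * A\<^sup>H * M"

text \<open>Rank: the maximal number of right linearly independent columns. The columns are addressed by
  index, so a repeated column is dependent.\<close>

definition right_indep_cols :: "quat mat \<Rightarrow> nat set \<Rightarrow> bool" where
  "right_indep_cols A J \<longleftrightarrow>
     (\<forall>c. (\<forall>i<dim_row A. (\<Sum>j\<in>J. A $$ (i, j) * c j) = 0) \<longrightarrow> (\<forall>j\<in>J. c j = 0))"

definition rank_quat_mat :: "quat mat \<Rightarrow> nat" where
  "rank_quat_mat A = Max {card J |J. J \<subseteq> {..<dim_col A} \<and> right_indep_cols A J}"


section \<open>Right eigenvalues\<close>

definition right_eigenvalue :: "quat mat \<Rightarrow> quat \<Rightarrow> bool" where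
  "right_eigenvalue B l \<longleftrightarrow>
     (\<exists>x \<in> carrier_vec (dim_row B). x \<noteq> 0\<^sub>v (dim_row B) \<and> B *\<^sub>v x = x \<cdot>\<^sub>r l)"

text \<open>Writing \<open>q = z + w j\<close> with complex \<open>z = qcomp1 q\<close>, \<open>w = qcomp2 q\<close>, and accordingly
  \<open>B = B\<^sub>1 + B\<^sub>2 j\<close>, the complex adjoint matrix of \<open>B\<close> has the blocks \<open>B\<^sub>1\<close>, \<open>B\<^sub>2\<close>, \<open>-cnj B\<^sub>2\<close>,
  \<open>cnj B\<^sub>1\<close>; it is the image of \<open>B\<close> under an injective ring homomorphism. Its characteristic
  polynomial has real coefficients, and its real roots have even order, since the right
  eigenvalues of \<open>B\<close> contribute to it in pairs \<open>\<lambda>, cnj \<lambda>\<close>. The multiplicity of a real right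
  eigenvalue of \<open>B\<close> is therefore half its order.\<close>

definition qcomp1 :: "quat \<Rightarrow> complex" where
  "qcomp1 q = Complex (qre q) (qim1 q)"

definition qcomp2 :: "quat \<Rightarrow> complex" where
  "qcomp2 q = Complex (qim2 q) (qim3 q)"

definition complex_adjoint_mat :: "quat mat \<Rightarrow> complex mat" where
  "complex_adjoint_mat B = four_block_mat
     (map_mat qcomp1 B) (map_mat qcomp2 B)
     (map_mat (\<lambda>q. - cnj (qcomp2 q)) B) (map_mat (\<lambda>q. cnj (qcomp1 q)) B)"

definition real_eigenvalue_mult :: "quat mat \<Rightarrow> real \<Rightarrow> nat" where
  "real_eigenvalue_mult B t = order (of_real t) (char_poly (complex_adjoint_mat B)) div 2"

text \<open>\<open>\<mu> 0, \<dots>, \<mu> (r - 1)\<close> is a complete list, with multiplicity, of the nonzero right eigenvalues of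
  \<open>B\<close>; in particular all of them are real.\<close>

definition lists_nonzero_eigenvalues :: "quat mat \<Rightarrow> nat \<Rightarrow> (nat \<Rightarrow> real) \<Rightarrow> bool" where
  "lists_nonzero_eigenvalues B r \<mu> \<longleftrightarrow>
     {l. right_eigenvalue B l \<and> l \<noteq> 0} = (\<lambda>i. of_real (\<mu> i)) ` {..<r} \<and>
     (\<forall>t. t \<noteq> 0 \<longrightarrow> real_eigenvalue_mult B t = card {i \<in> {..<r}. \<mu> i = t})"

text \<open>The \<open>m \<times> n\<close> matrix with leading block \<open>diag(\<sigma> 0, \<dots>, \<sigma> (r - 1))\<close> and zeros elsewhere, for
  \<open>r \<le> min m n\<close>.\<close>

definition sigma_block_mat :: "nat \<Rightarrow> nat \<Rightarrow> nat \<Rightarrow> (nat \<Rightarrow> real) \<Rightarrow> quat mat" where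
  "sigma_block_mat m n r \<sigma> = four_block_mat
     (mat_diag r (\<lambda>i. of_real (\<sigma> i))) (0\<^sub>m r (n - r))
     (0\<^sub>m (m - r) r) (0\<^sub>m (m - r) (n - r))"

end

theory Submission
  imports Defs "HOL-Computational_Algebra.Fundamental_Theorem_Algebra"
begin

text \<open>The matrix \<open>A\<^sup>* M A\<close> is Hermitian and positive semidefinite, so it can be diagonalized
  simultaneously with \<open>N\<close>: there is an \<open>N\<close>-orthonormal basis \<open>w\<^sub>1, \<dots>, w\<^sub>n\<close> with
  \<open>A\<^sup>* M A w\<^sub>i = N w\<^sub>i t\<^sub>i\<close> and real \<open>t\<^sub>1 \<ge> \<dots> \<ge> t\<^sub>n \<ge> 0\<close>. For \<open>t\<^sub>i > 0\<close> put \<open>\<sigma>\<^sub>i = \<surd>t\<^sub>i\<close> and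
  \<open>u\<^sub>i = A w\<^sub>i / \<sigma>\<^sub>i\<close>; these vectors are \<open>M\<close>-orthonormal and extend to an \<open>M\<close>-orthonormal basis. With
  \<open>U\<close> and \<open>W\<close> the matrices of columns, \<open>A W = U D\<close>, and \<open>V = N W\<close> satisfies
  \<open>V\<^sup>* = W\<^sup>-\<^sup>1\<close>. Moreover \<open>A\<^sup>\<sharp> U = W D\<^sup>*\<close>, so \<open>W\<close> and \<open>U\<close> diagonalize \<open>A\<^sup>\<sharp> A\<close> and \<open>A A\<^sup>\<sharp>\<close>.
  Eigenvectors of Hermitian quaternion matrices come from the complex adjoint matrix; all dimension
  arguments reduce to the solvability of underdetermined homogeneous systems over a division ring.\<close>

section \<open>Quaternions and their conjugation\<close>

lemma qcnj_simps [simp]: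
  "qcnj 0 = 0" "qcnj 1 = 1" "qcnj (qcnj p) = p" "qcnj (of_real t) = of_real t"
  "qcnj (p + q) = qcnj p + qcnj q" "qcnj (p * q) = qcnj q * qcnj p"
  by (simp_all add: quat_eq_iff one_quat_def times_quat_def of_real_def)

lemma qcnj_sum: "qcnj (sum f S) = (\<Sum>i\<in>S. qcnj (f i))"
  by (induction S rule: infinite_finite_induct) simp_all

lemma qcnj_eq_self: "qcnj p = p \<Longrightarrow> p = of_real (qre p)"
  by (simp add: quat_eq_iff one_quat_def of_real_def)

lemma of_real_mult_commute: "of_real t * p = p * (of_real t :: 'a :: real_algebra_1)"
  by (simp add: of_real_def)

lemma qcomp_eq_iff: "p = q \<longleftrightarrow> qcomp1 p = qcomp1 q \<and> qcomp2 p = qcomp2 q"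
  by (auto simp: qcomp1_def qcomp2_def quat_eq_iff)

text \<open>Writing \<open>p = z + w j\<close>, the rules \<open>j z = cnj z j\<close> and
  \<open>j^2 = -1\<close> produce both formulas.\<close>

lemma qcomp_mult:
  "qcomp1 (p * q) = qcomp1 p * qcomp1 q - qcomp2 p * cnj (qcomp2 q)"
  "qcomp2 (p * q) = qcomp1 p * qcomp2 q + qcomp2 p * cnj (qcomp1 q)"
  by (simp_all add: qcomp1_def qcomp2_def complex_eq_iff times_quat_def)

lemma qcomp_simps [simp]:
  "qcomp1 0 = 0" "qcomp2 0 = 0" "qcomp1 1 = 1" "qcomp2 1 = 0"
  "qcomp1 (of_real t) = of_real t" "qcomp2 (of_real t) = 0"
  "qcomp1 (p + q) = qcomp1 p + qcomp1 q" "qcomp2 (p + q) = qcomp2 p + qcomp2 q"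
  by (simp_all add: qcomp1_def qcomp2_def complex_eq_iff one_quat_def of_real_def)

lemma qcomp_sum:
  "qcomp1 (sum f S) = (\<Sum>i\<in>S. qcomp1 (f i))" "qcomp2 (sum f S) = (\<Sum>i\<in>S. qcomp2 (f i))"
  by (induction S rule: infinite_finite_induct) simp_all

lemma sum_lessThan_plus:
  fixes f :: "nat \<Rightarrow> 'a :: comm_monoid_add"
  shows "sum f {..<m + n} = sum f {..<m} + (\<Sum>i<n. f (m + i))"
  by (induction n) (simp_all add: add.assoc)

section \<open>The complex adjoint matrix\<close>

lemma complex_adjoint_carrier [simp]:
  "B \<in> carrier_mat p q \<Longrightarrow> complex_adjoint_mat B \<in> carrier_mat (p + p) (q + q)"
  by (auto simp: complex_adjoint_mat_def)

text \<open>Block multiplication leaves four identities, each of them \<open>qcomp_mult\<close>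
  summed over the entries; the lower two are, up to sign, conjugates of the upper two.\<close>

lemma complex_adjoint_mult:
  assumes A: "A \<in> carrier_mat p q" and B: "B \<in> carrier_mat q s"
  shows "complex_adjoint_mat (A * B) = complex_adjoint_mat A * complex_adjoint_mat B"
proof -
  let ?a = "map_mat qcomp1" and ?b = "map_mat qcomp2"
    and ?c = "map_mat (\<lambda>q. - cnj (qcomp2 q))" and ?d = "map_mat (\<lambda>q. cnj (qcomp1 q))"
  have *: "complex_adjoint_mat A * complex_adjoint_mat B = four_block_mat
      (?a A * ?a B + ?b A * ?c B) (?a A * ?b B + ?b A * ?d B)
      (?c A * ?a B + ?d A * ?c B) (?c A * ?b B + ?d A * ?d B)"
    unfolding complex_adjoint_mat_def
    by (rule mult_four_block_mat) (use A B in auto)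
  have e1: "?a (A * B) = ?a A * ?a B + ?b A * ?c B"
    by (rule eq_matI) (use A B in \<open>auto simp: scalar_prod_def qcomp_sum qcomp_mult
        sum.distrib sum_negf sum_subtractf\<close>)
  have e2: "?b (A * B) = ?a A * ?b B + ?b A * ?d B"
    by (rule eq_matI) (use A B in \<open>auto simp: scalar_prod_def qcomp_sum qcomp_mult
        sum.distrib\<close>)
  have e3: "?c (A * B) = ?c A * ?a B + ?d A * ?c B"
    by (rule eq_matI) (use A B in \<open>auto simp: scalar_prod_def qcomp_sum qcomp_mult
        sum.distrib sum_negf\<close>)
  have e4: "?d (A * B) = ?c A * ?b B + ?d A * ?d B"
    by (rule eq_matI) (use A B in \<open>auto simp: scalar_prod_def qcomp_sum qcomp_mult
        sum.distrib sum_negf sum_subtractf\<close>)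
  show ?thesis
    unfolding * unfolding complex_adjoint_mat_def e1 e2 e3 e4 ..
qed

text \<open>The upper two blocks already contain both complex components of every entry.\<close>

lemma complex_adjoint_inj:
  assumes A: "A \<in> carrier_mat p q" and B: "B \<in> carrier_mat p q"
    and eq: "complex_adjoint_mat A = complex_adjoint_mat B"
  shows "A = B"
proof (rule eq_matI)
  fix i j
  assume ij: "i < dim_row B" "j < dim_col B"
  have "complex_adjoint_mat A $$ (i, j) = complex_adjoint_mat B $$ (i, j)"
    "complex_adjoint_mat A $$ (i, q + j) = complex_adjoint_mat B $$ (i, q + j)"
    by (simp_all add: eq)
  then show "A $$ (i, j) = B $$ (i, j)"
    using A B ij by (auto simp: complex_adjoint_mat_def qcomp_eq_iff)
qed (use A B in auto)

lemma complex_adjoint_diag: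
  "complex_adjoint_mat (mat_diag n (\<lambda>i. of_real (d i))) = four_block_mat
     (mat_diag n (\<lambda>i. of_real (d i))) (0\<^sub>m n n) (0\<^sub>m n n) (mat_diag n (\<lambda>i. of_real (d i)))"
  unfolding complex_adjoint_mat_def
  by (rule cong_four_block_mat; rule eq_matI) (auto simp: mat_diag_def)

lemma complex_adjoint_one: "complex_adjoint_mat (1\<^sub>m n) = 1\<^sub>m (n + n)"
  using complex_adjoint_diag[of n "\<lambda>i. 1"] by simp

text \<open>The complex adjoint carries the equation to complex matrices, where a one-sided inverse
  is two-sided; injectivity brings the result back.\<close>

lemma quat_mat_mult_left_right_inverse:
  fixes A B :: "quat mat"
  assumes A: "A \<in> carrier_mat n n" and B: "B \<in> carrier_mat n n" and AB: "A * B = 1\<^sub>m n"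
  shows "B * A = 1\<^sub>m n"
proof -
  have "complex_adjoint_mat A * complex_adjoint_mat B = 1\<^sub>m (n + n)"
    using complex_adjoint_mult[OF A B] AB by (simp add: complex_adjoint_one)
  then have "complex_adjoint_mat B * complex_adjoint_mat A = 1\<^sub>m (n + n)"
    using A B mat_mult_left_right_inverse complex_adjoint_carrier by blast
  then have "complex_adjoint_mat (B * A) = complex_adjoint_mat (1\<^sub>m n)"
    using complex_adjoint_mult[OF B A] by (simp add: complex_adjoint_one)
  then show ?thesis
    using A B by (intro complex_adjoint_inj) auto
qed

text \<open>A complex eigenvector \<open>(a, b)\<close> of the complex adjoint matrix is the first column of the
  complex adjoint of the quaternion vector \<open>a - cnj b j\<close>.\<close>

lemma ex_right_eigenvalue:
  assumes B: "B \<in> carrier_mat n n" and "n > 0"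
  shows "\<exists>x l. x \<in> carrier_vec n \<and> x \<noteq> 0\<^sub>v n \<and> B *\<^sub>v x = x \<cdot>\<^sub>r l"
proof -
  let ?C = "complex_adjoint_mat B"
  have C: "?C \<in> carrier_mat (n + n) (n + n)"
    using B by simp
  have "degree (char_poly ?C) = n + n"
    using degree_monic_char_poly[OF C] by simp
  then have "\<not> constant (poly (char_poly ?C))"
    using \<open>n > 0\<close> by (simp add: constant_degree)
  then obtain l where "poly (char_poly ?C) l = 0"
    using fundamental_theorem_of_algebra by blast
  then have "eigenvalue ?C l"
    using eigenvalue_root_char_poly[OF C] by simp
  then obtain v where v: "v \<in> carrier_vec (n + n)" "v \<noteq> 0\<^sub>v (n + n)" "?C *\<^sub>v v = l \<cdot>\<^sub>v v"
    using C by (auto simp: eigenvalue_def eigenvector_def)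
  define mk where "mk a b = Quat (Re a) (Im a) (- Re b) (Im b)" for a b
  have mk: "qcomp1 (mk a b) = a" "qcomp2 (mk a b) = - cnj b" for a b
    by (simp_all add: mk_def qcomp1_def qcomp2_def complex_eq_iff)
  define x where "x = vec n (\<lambda>i. mk (v $ i) (v $ (n + i)))"
  \<comment> \<open>Right multiplication by this complex scalar multiplies the first component by
    \<open>l\<close> and the second by \<open>cnj l\<close>, matching the conjugate in
    \<open>mk\<close>.\<close>
  define l' where "l' = mk l 0"
  have row: "(\<Sum>j<n. ?C $$ (i, j) * v $ j) + (\<Sum>j<n. ?C $$ (i, n + j) * v $ (n + j)) = l * v $ i"
    if "i < n + n" for i
  proof -
    have "(?C *\<^sub>v v) $ i = (\<Sum>j<n + n. ?C $$ (i, j) * v $ j)"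
      using C v(1) that by (auto simp: scalar_prod_def lessThan_atLeast0 intro!: sum.cong)
    also have "\<dots> = (\<Sum>j<n. ?C $$ (i, j) * v $ j) + (\<Sum>j<n. ?C $$ (i, n + j) * v $ (n + j))"
      by (rule sum_lessThan_plus)
    finally show ?thesis
      using v that by simp
  qed
  have "B *\<^sub>v x = x \<cdot>\<^sub>r l'"
  proof (rule eq_vecI)
    fix i assume "i < dim_vec (x \<cdot>\<^sub>r l')"
    then have i: "i < n" by (simp add: vec_smult_right_def x_def)
    show "(B *\<^sub>v x) $ i = (x \<cdot>\<^sub>r l') $ i"
    proof -
      have *: "(B *\<^sub>v x) $ i = (\<Sum>j<n. B $$ (i, j) * mk (v $ j) (v $ (n + j)))"
        using B i by (auto simp: scalar_prod_def x_def lessThan_atLeast0 intro!: sum.cong)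
      have "qcomp1 ((B *\<^sub>v x) $ i) = l * v $ i"
        using row[of i] B i
        by (simp add: * qcomp_sum qcomp_mult mk sum.distrib complex_adjoint_mat_def)
      \<comment> \<open>The lower half of the complex equation, conjugated and negated, is the
        second component of the quaternion equation.\<close>
      moreover have "qcomp2 ((B *\<^sub>v x) $ i) = - cnj (l * v $ (n + i))"
        using arg_cong[OF row[of "n + i"], of "\<lambda>z. - cnj z"] B i
        by (simp add: * qcomp_sum qcomp_mult mk sum.distrib complex_adjoint_mat_def sum_negf sum_subtractf)
      ultimately show ?thesis
        using i by (simp add: qcomp_eq_iff qcomp_mult mk l'_def x_def vec_smult_right_def)
    qed
  qed (use B in \<open>auto simp: vec_smult_right_def x_def\<close>)
  moreover have "x \<noteq> 0\<^sub>v n"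
  proof
    assume x0: "x = 0\<^sub>v n"
    have "v $ i = 0 \<and> v $ (n + i) = 0" if "i < n" for i
    proof -
      have "x $ i = 0" using x0 that by simp
      then show ?thesis
        using that by (simp add: x_def qcomp_eq_iff mk)
    qed
    then have "v $ i = 0" if "i < n + n" for i
      using that by (metis add_diff_inverse_nat nat_add_left_cancel_less)
    then have "v = 0\<^sub>v (n + n)"
      using v(1) by (intro eq_vecI) auto
    with v(2) show False by simp
  qed
  moreover have "x \<in> carrier_vec n" by (simp add: x_def)
  ultimately show ?thesis by blast
qed

section \<open>Homogeneous linear systems over a division ring\<close>

text \<open>Gaussian elimination by induction on the equations. Coefficients stay to the left of the
  unknowns throughout, so commutativity is never invoked.\<close>

lemma homogeneous_system_nontrivial:
  fixes a :: "'e \<Rightarrow> 'i \<Rightarrow> 'a :: division_ring"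
  assumes "finite I" "finite J" "card I < card J"
  shows "\<exists>c. (\<exists>j\<in>J. c j \<noteq> 0) \<and> (\<forall>i\<in>I. (\<Sum>j\<in>J. a i j * c j) = 0)"
  using assms
proof (induction I arbitrary: a J rule: finite_induct)
  case empty
  then have "J \<noteq> {}" by auto
  show ?case
    by (rule exI[of _ "\<lambda>_. 1"]) (use \<open>J \<noteq> {}\<close> in auto)
next
  case (insert k I)
  show ?case
  proof (cases "\<forall>j\<in>J. a k j = 0")
    \<comment> \<open>Equation \<open>k\<close> is trivial and is dropped, while all unknowns are
      kept.\<close>
    case True
    have "card I < card J"
      using insert.hyps insert.prems by simp
    then obtain c where "\<exists>j\<in>J. c j \<noteq> 0" "\<And>i. i \<in> I \<Longrightarrow> (\<Sum>j\<in>J. a i j * c j) = 0"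
      using insert.IH[OF insert.prems(1), of a] by auto
    with True show ?thesis
      by (intro exI[of _ c]) auto
  next
    case False
    then obtain p where p: "p \<in> J" "a k p \<noteq> 0" by blast
    define J' where "J' = J - {p}"
    have J': "finite J'" "card I < card J'" "J = Set.insert p J'" "p \<notin> J'"
      using insert.hyps insert.prems p by (auto simp: J'_def)
    \<comment> \<open>These are the coefficients after equation \<open>k\<close>, solved for the
      pivot unknown \<open>p\<close>, is substituted into the others.\<close>
    obtain c where c: "\<exists>j\<in>J'. c j \<noteq> 0"
      "\<And>i. i \<in> I \<Longrightarrow> (\<Sum>j\<in>J'. (a i j - a i p * inverse (a k p) * a k j) * c j) = 0"
      using insert.IH[OF J'(1,2), of "\<lambda>i j. a i j - a i p * inverse (a k p) * a k j"] by blast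
    \<comment> \<open>The value at \<open>p\<close> is the one forced by equation
      \<open>k\<close>.\<close>
    define c' where "c' = c(p := - inverse (a k p) * (\<Sum>j\<in>J'. a k j * c j))"
    have sum_eq: "(\<Sum>j\<in>J. a i j * c' j)
        = (\<Sum>j\<in>J'. a i j * c j) - a i p * inverse (a k p) * (\<Sum>j\<in>J'. a k j * c j)" for i
    proof -
      have "(\<Sum>j\<in>J'. a i j * c' j) = (\<Sum>j\<in>J'. a i j * c j)"
        using J'(4) by (intro sum.cong) (auto simp: c'_def)
      then show ?thesis
        using J' by (simp add: c'_def mult.assoc)
    qed
    have "(\<Sum>j\<in>J. a i j * c' j) = 0" if "i \<in> Set.insert k I" for i
    proof (cases "i = k")
      case True
      then show ?thesis using p by (simp add: sum_eq)
    next
      case False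
      then show ?thesis
        using c(2)[of i] that
        by (simp add: sum_eq left_diff_distrib sum_subtractf sum_distrib_left mult.assoc)
    qed
    moreover have "\<exists>j\<in>J. c' j \<noteq> 0"
      using c(1) J'(3,4) by (auto simp: c'_def)
    ultimately show ?thesis by blast
  qed
qed

section \<open>Adjoints and the Hermitian pairing\<close>

text \<open>The standard Hermitian form, conjugate-linear on the left and right-linear on the right;
  \<open>pos_def_quat_mat\<close> is about \<open>cip x (P x)\<close>.\<close>

definition cip :: "quat vec \<Rightarrow> quat vec \<Rightarrow> quat" where
  "cip x y = map_vec qcnj x \<bullet> y"

lemma adjoint_carrier [simp]: "A \<in> carrier_mat m n \<Longrightarrow> A\<^sup>H \<in> carrier_mat n m"
  by (simp add: adjoint_quat_mat_def)

lemma adjoint_dims [simp]: "dim_row (A\<^sup>H) = dim_col A" "dim_col (A\<^sup>H) = dim_row A"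
  by (simp_all add: adjoint_quat_mat_def)

lemma adjoint_index [simp]:
  "A \<in> carrier_mat m n \<Longrightarrow> i < n \<Longrightarrow> j < m \<Longrightarrow> A\<^sup>H $$ (i, j) = qcnj (A $$ (j, i))"
  by (simp add: adjoint_quat_mat_def)

lemma adjoint_adjoint [simp]: "(A\<^sup>H)\<^sup>H = A"
  by (rule eq_matI) (auto simp: adjoint_quat_mat_def)

text \<open>Transposition alone does not reverse products of quaternion matrices; it does so
  together with \<open>qcnj\<close>, which reverses products of entries.\<close>

lemma adjoint_mult:
  assumes "A \<in> carrier_mat m n" "B \<in> carrier_mat n p"
  shows "(A * B)\<^sup>H = B\<^sup>H * A\<^sup>H"
  by (rule eq_matI)
    (use assms in \<open>auto simp: adjoint_quat_mat_def scalar_prod_def qcnj_sum intro!: sum.cong\<close>)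

section \<open>Right scalar multiples and sesquilinearity of the pairing\<close>

lemma smult_right_carrier [simp]: "x \<in> carrier_vec n \<Longrightarrow> x \<cdot>\<^sub>r c \<in> carrier_vec n"
  by (simp add: vec_smult_right_def)

lemma smult_right_index [simp]: "i < dim_vec x \<Longrightarrow> (x \<cdot>\<^sub>r c) $ i = x $ i * c"
  by (simp add: vec_smult_right_def)

lemma smult_right_dim [simp]: "dim_vec (x \<cdot>\<^sub>r c) = dim_vec x"
  by (simp add: vec_smult_right_def)

lemma mult_mat_vec_smult_right:
  "A \<in> carrier_mat m n \<Longrightarrow> x \<in> carrier_vec n \<Longrightarrow> A *\<^sub>v (x \<cdot>\<^sub>r c) = (A *\<^sub>v x) \<cdot>\<^sub>r c"
  by (rule eq_vecI) (auto simp: scalar_prod_def sum_distrib_right mult.assoc)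

lemma smult_right_smult_right: "(x \<cdot>\<^sub>r a) \<cdot>\<^sub>r b = x \<cdot>\<^sub>r (a * b)"
  by (rule eq_vecI) (auto simp: mult.assoc)

lemma mult_mat_vec_zero: "(A :: quat mat) \<in> carrier_mat m n \<Longrightarrow> A *\<^sub>v 0\<^sub>v n = 0\<^sub>v m"
  by (rule eq_vecI) auto

lemma cip_sum: "y \<in> carrier_vec n \<Longrightarrow> x \<in> carrier_vec n \<Longrightarrow> cip x y = (\<Sum>i<n. qcnj (x $ i) * y $ i)"
  by (auto simp: cip_def scalar_prod_def lessThan_atLeast0)

lemma qcnj_cip: "x \<in> carrier_vec n \<Longrightarrow> y \<in> carrier_vec n \<Longrightarrow> qcnj (cip x y) = cip y x"
  by (simp add: cip_sum qcnj_sum)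

lemma cip_smult_right:
  "x \<in> carrier_vec n \<Longrightarrow> y \<in> carrier_vec n \<Longrightarrow> cip x (y \<cdot>\<^sub>r c) = cip x y * c"
  by (simp add: cip_sum[of _ n] sum_distrib_right mult.assoc)

lemma cip_smult_left:
  "x \<in> carrier_vec n \<Longrightarrow> y \<in> carrier_vec n \<Longrightarrow> cip (x \<cdot>\<^sub>r c) y = qcnj c * cip x y"
  by (simp add: cip_sum[of _ n] sum_distrib_left mult.assoc)

lemma cip_diff_right:
  assumes "x \<in> carrier_vec n" "y \<in> carrier_vec n" "z \<in> carrier_vec n"
  shows "cip x (y - z) = cip x y - cip x z"
proof -
  have "cip x (y - z) = (\<Sum>i<n. qcnj (x $ i) * y $ i - qcnj (x $ i) * z $ i)"
    using assms by (subst cip_sum[of _ n]) (auto simp: right_diff_distrib intro!: sum.cong)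
  then show ?thesis
    using assms by (simp add: cip_sum[of _ n] sum_subtractf)
qed

lemma cip_zero_right [simp]: "x \<in> carrier_vec n \<Longrightarrow> cip x (0\<^sub>v n) = 0"
  by (simp add: cip_sum[of _ n])

lemma cip_mult_mat_vec:
  assumes "W \<in> carrier_mat m k" "x \<in> carrier_vec m" "z \<in> carrier_vec k"
  shows "cip x (W *\<^sub>v z) = (\<Sum>j<k. cip x (col W j) * z $ j)"
proof -
  have "cip x (W *\<^sub>v z) = (\<Sum>i<m. \<Sum>j<k. qcnj (x $ i) * (W $$ (i, j) * z $ j))"
    using assms by (simp add: cip_sum[of _ m] scalar_prod_def sum_distrib_left lessThan_atLeast0)
  also have "\<dots> = (\<Sum>j<k. \<Sum>i<m. qcnj (x $ i) * (W $$ (i, j) * z $ j))"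
    by (rule sum.swap)
  also have "\<dots> = (\<Sum>j<k. cip x (col W j) * z $ j)"
    using assms by (auto simp: cip_sum[of _ m] sum_distrib_right mult.assoc intro!: sum.cong)
  finally show ?thesis .
qed

lemma adjoint_mult_vec_index:
  assumes "A \<in> carrier_mat m n" "y \<in> carrier_vec m" "i < n"
  shows "(A\<^sup>H *\<^sub>v y) $ i = cip (col A i) y"
  using assms by (auto simp: cip_sum[of _ m] adjoint_quat_mat_def scalar_prod_def lessThan_atLeast0)

lemma cip_adjoint:
  assumes "A \<in> carrier_mat m n" "x \<in> carrier_vec n" "y \<in> carrier_vec m"
  shows "cip x (A\<^sup>H *\<^sub>v y) = cip (A *\<^sub>v x) y"
proof -
  have "cip x (A\<^sup>H *\<^sub>v y) = (\<Sum>i<n. qcnj (x $ i) * qcnj (cip y (col A i)))"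
    using assms
    by (subst cip_sum[of _ n])
      (auto simp: adjoint_mult_vec_index[OF assms(1,3)] qcnj_cip[of _ m] simp del: index_mult_mat_vec
        intro!: mult_mat_vec_carrier)
  also have "\<dots> = qcnj (cip y (A *\<^sub>v x))"
    using assms by (simp add: cip_mult_mat_vec qcnj_sum)
  also have "\<dots> = cip (A *\<^sub>v x) y"
    using assms by (intro qcnj_cip) auto
  finally show ?thesis .
qed

section \<open>Hermitian matrices and their real eigenvalues\<close>

lemma cip_hermitian:
  assumes "P \<in> carrier_mat n n" "hermitian_quat_mat P" "x \<in> carrier_vec n" "y \<in> carrier_vec n"
  shows "cip x (P *\<^sub>v y) = cip (P *\<^sub>v x) y"
  using cip_adjoint[OF assms(1,3,4)] assms(2) by (simp add: hermitian_quat_mat_def)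

text \<open>Each \<open>qcnj p * p\<close> is the real number \<open>qnorm_sq p\<close>, so
  \<open>cip x x\<close> is a sum of nonnegative reals.\<close>

lemma cip_self_eq_0_iff:
  assumes "x \<in> carrier_vec n"
  shows "cip x x = 0 \<longleftrightarrow> x = 0\<^sub>v n"
proof -
  have "qcnj p * p = of_real (qnorm_sq p)" for p
    by (simp add: quat_eq_iff times_quat_def one_quat_def of_real_def qnorm_sq_def power2_eq_square)
  then have "cip x x = of_real (\<Sum>i<n. qnorm_sq (x $ i))"
    using assms by (simp add: cip_sum)
  moreover have "0 \<le> qnorm_sq p" for p
    by (simp add: qnorm_sq_def)
  ultimately have "cip x x = 0 \<longleftrightarrow> (\<forall>i<n. qnorm_sq (x $ i) = 0)"
    by (simp add: sum_nonneg_eq_0_iff Ball_def del: of_real_sum)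
  also have "\<dots> \<longleftrightarrow> x = 0\<^sub>v n"
    using assms by (auto simp: qnorm_sq_eq_0 intro!: eq_vecI)
  finally show ?thesis .
qed

text \<open>Any right eigenvalue \<open>l\<close> is real: evaluating \<open>cip x (H x)\<close>
  from both sides gives \<open>s * l = qcnj l * s\<close> with \<open>s = cip x x\<close>, and
  \<open>s\<close> is a nonzero real, hence central and cancellable.\<close>

lemma ex_real_eigenvalue_hermitian:
  assumes H: "H \<in> carrier_mat n n" "hermitian_quat_mat H" and "n > 0"
  shows "\<exists>x t. x \<in> carrier_vec n \<and> x \<noteq> 0\<^sub>v n \<and> H *\<^sub>v x = x \<cdot>\<^sub>r of_real t"
proof -
  obtain x l where x: "x \<in> carrier_vec n" "x \<noteq> 0\<^sub>v n" "H *\<^sub>v x = x \<cdot>\<^sub>r l"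
    using ex_right_eigenvalue[OF H(1) \<open>n > 0\<close>] by blast
  define s where "s = cip x x"
  have s: "s \<noteq> 0" "s = of_real (qre s)"
    using x cip_self_eq_0_iff[OF x(1)] qcnj_cip[OF x(1,1)] qcnj_eq_self by (auto simp: s_def)
  have "s * l = cip x (H *\<^sub>v x)"
    using x by (simp add: s_def cip_smult_right[of _ n])
  also have "\<dots> = qcnj l * s"
    using x by (subst cip_hermitian[OF H x(1,1)]) (simp add: s_def cip_smult_left[of _ n])
  also have "\<dots> = s * qcnj l"
    using s(2) of_real_mult_commute by metis
  finally have "qcnj l = l"
    using s(1) by simp
  then show ?thesis
    using x qcnj_eq_self by metis
qed

section \<open>Orthonormal families for a positive definite matrix\<close>

text \<open>Only the values below \<open>k\<close> are constrained, so a family grows by function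
  update at \<open>k\<close>.\<close>

definition orthonormal_family :: "nat \<Rightarrow> quat mat \<Rightarrow> nat \<Rightarrow> (nat \<Rightarrow> quat vec) \<Rightarrow> bool" where
  "orthonormal_family n M k w \<longleftrightarrow> (\<forall>i<k. w i \<in> carrier_vec n) \<and>
     (\<forall>i<k. \<forall>j<k. cip (w i) (M *\<^sub>v w j) = of_bool (i = j))"

definition frame_mat :: "nat \<Rightarrow> nat \<Rightarrow> (nat \<Rightarrow> quat vec) \<Rightarrow> quat mat" where
  "frame_mat n k w = mat n k (\<lambda>(i, j). w j $ i)"

lemma frame_mat_carrier [simp]: "frame_mat n k w \<in> carrier_mat n k"
  by (simp add: frame_mat_def)

lemma frame_mat_dims [simp]: "dim_row (frame_mat n k w) = n" "dim_col (frame_mat n k w) = k"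
  by (simp_all add: frame_mat_def)

lemma col_frame_mat [simp]: "j < k \<Longrightarrow> w j \<in> carrier_vec n \<Longrightarrow> col (frame_mat n k w) j = w j"
  by (auto simp: frame_mat_def)

lemma pos_def_carrier: "pos_def_quat_mat n M \<Longrightarrow> M \<in> carrier_mat n n"
  and pos_def_hermitian: "pos_def_quat_mat n M \<Longrightarrow> hermitian_quat_mat M"
  and pos_def_cip: "pos_def_quat_mat n M \<Longrightarrow> x \<in> carrier_vec n \<Longrightarrow> x \<noteq> 0\<^sub>v n \<Longrightarrow>
    \<exists>t>0. cip x (M *\<^sub>v x) = of_real t"
  by (auto simp: pos_def_quat_mat_def cip_def)

text \<open>Normalization by \<open>1 / sqrt t\<close>, where \<open>t\<close> is the squared
  \<open>M\<close>-norm of \<open>y\<close>. The factor is recorded as real because real multiples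
  of an eigenvector satisfy the same eigenvector equation.\<close>

lemma orthonormal_family_append:
  assumes M: "pos_def_quat_mat n M" and w: "orthonormal_family n M k w"
    and y: "y \<in> carrier_vec n" "y \<noteq> 0\<^sub>v n" "\<And>i. i < k \<Longrightarrow> cip (w i) (M *\<^sub>v y) = 0"
  shows "\<exists>c::real. orthonormal_family n M (Suc k) (w(k := y \<cdot>\<^sub>r of_real c))"
proof -
  note Mc = pos_def_carrier[OF M]
  obtain t where t: "t > 0" "cip y (M *\<^sub>v y) = of_real t"
    using pos_def_cip[OF M y(1,2)] by blast
  define c where "c = 1 / sqrt t"
  define y' where "y' = y \<cdot>\<^sub>r of_real c"
  have My: "M *\<^sub>v y' = (M *\<^sub>v y) \<cdot>\<^sub>r of_real c" and Myc: "M *\<^sub>v y \<in> carrier_vec n"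
    and y'c: "y' \<in> carrier_vec n" and My'c: "M *\<^sub>v y' \<in> carrier_vec n"
    using Mc y(1) by (auto simp: y'_def mult_mat_vec_smult_right intro!: mult_mat_vec_carrier)
  have "cip y' (M *\<^sub>v y') = of_real c * (of_real t * of_real c)"
    using y(1) Myc t by (simp add: My) (simp add: y'_def mult.assoc cip_smult_left[of _ n] cip_smult_right[of _ n])
  also have "\<dots> = of_real (c * (t * c))" by simp
  also have "c * (t * c) = 1"
    using t(1) by (simp add: c_def field_simps)
  finally have 1: "cip y' (M *\<^sub>v y') = 1" by simp
  have wc: "w i \<in> carrier_vec n" if "i < k" for i
    using w that by (simp add: orthonormal_family_def)
  have 2: "cip (w i) (M *\<^sub>v y') = 0" if "i < k" for i
    using y(3)[OF that] wc[OF that] Myc by (simp add: My cip_smult_right[of _ n])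
  have 3: "cip y' (M *\<^sub>v w i) = 0" if "i < k" for i
  proof -
    have "cip y' (M *\<^sub>v w i) = qcnj (cip (w i) (M *\<^sub>v y'))"
      using cip_hermitian[OF Mc pos_def_hermitian[OF M] y'c wc[OF that]]
        qcnj_cip[OF wc[OF that] My'c] by simp
    then show ?thesis using 2[OF that] by simp
  qed
  have "orthonormal_family n M (Suc k) (w(k := y'))"
    using w 1 2 3 y'c by (auto simp: orthonormal_family_def less_Suc_eq)
  then show ?thesis by (auto simp: y'_def)
qed

text \<open>Orthogonality imposes \<open>k\<close> linear equations on \<open>n > k\<close>
  coordinates.\<close>

lemma ex_orthogonal_vec:
  assumes M: "M \<in> carrier_mat n n" and w: "\<And>i. i < k \<Longrightarrow> w i \<in> carrier_vec n" and "k < n"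
  shows "\<exists>y. y \<in> carrier_vec n \<and> y \<noteq> 0\<^sub>v n \<and> (\<forall>i<k. cip (w i) (M *\<^sub>v y) = 0)"
proof -
  obtain c where c: "\<exists>j\<in>{..<n}. c j \<noteq> 0"
    "\<And>i. i < k \<Longrightarrow> (\<Sum>j\<in>{..<n}. cip (w i) (col M j) * c j) = 0"
    using homogeneous_system_nontrivial[of "{..<k}" "{..<n}" "\<lambda>i j. cip (w i) (col M j)"] \<open>k < n\<close> by auto
  have "vec n c \<noteq> 0\<^sub>v n"
    using c(1) by (metis index_vec index_zero_vec(1) lessThan_iff)
  moreover have "cip (w i) (M *\<^sub>v vec n c) = 0" if "i < k" for i
    using c(2)[OF that] M w[OF that] by (simp add: cip_mult_mat_vec)
  ultimately show ?thesis
    by (intro exI[of _ "vec n c"]) auto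
qed

text \<open>Downward induction from \<open>k = n\<close>: a normalized orthogonal vector is
  appended, and the hypothesis for \<open>Suc k\<close> completes the longer family.\<close>

lemma orthonormal_family_extend:
  assumes M: "pos_def_quat_mat n M" and "orthonormal_family n M k w" "k \<le> n"
  shows "\<exists>w'. orthonormal_family n M n w' \<and> (\<forall>i<k. w' i = w i)"
  using assms(3,2)
proof (induction k arbitrary: w rule: inc_induct)
  case base
  then show ?case by blast
next
  case (step k)
  obtain y where "y \<in> carrier_vec n" "y \<noteq> 0\<^sub>v n" "\<And>i. i < k \<Longrightarrow> cip (w i) (M *\<^sub>v y) = 0"
    using ex_orthogonal_vec[OF pos_def_carrier[OF M], of k w] step
    by (auto simp: orthonormal_family_def)
  then obtain c :: real where "orthonormal_family n M (Suc k) (w(k := y \<cdot>\<^sub>r of_real c))"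
    using orthonormal_family_append[OF M step.prems] by blast
  from step.IH[OF this] show ?case
    by (metis fun_upd_other less_Suc_eq nat_neq_iff)
qed

text \<open>More than \<open>n\<close> vectors of length \<open>n\<close> satisfy a nontrivial right
  linear relation, yet pairing the relation with each member isolates its coefficient and makes it
  zero.\<close>

lemma orthonormal_family_card_le:
  assumes M: "M \<in> carrier_mat n n" and w: "orthonormal_family n M k w"
  shows "k \<le> n"
proof (rule ccontr)
  assume "\<not> k \<le> n"
  then obtain c where c: "\<exists>j\<in>{..<k}. c j \<noteq> 0"
    "\<And>i. i < n \<Longrightarrow> (\<Sum>j\<in>{..<k}. w j $ i * c j) = 0"
    using homogeneous_system_nontrivial[of "{..<n}" "{..<k}" "\<lambda>i j. w j $ i"] by auto
  let ?F = "frame_mat n k w"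
  have wc: "w i \<in> carrier_vec n" if "i < k" for i
    using w that by (simp add: orthonormal_family_def)
  have "?F *\<^sub>v vec k c = 0\<^sub>v n"
    by (rule eq_vecI) (use c(2) in \<open>auto simp: frame_mat_def scalar_prod_def lessThan_atLeast0\<close>)
  then have 0: "(M * ?F) *\<^sub>v vec k c = 0\<^sub>v n"
    using M by (simp add: assoc_mult_mat_vec[of _ n n _ k] mult_mat_vec_zero)
  have "c i = 0" if "i < k" for i
  proof -
    have "0 = cip (w i) ((M * ?F) *\<^sub>v vec k c)"
      unfolding 0 using wc[OF that] by simp
    also have "\<dots> = (\<Sum>j<k. cip (w i) (M *\<^sub>v w j) * c j)"
      using M wc wc[OF that]
      by (subst cip_mult_mat_vec[of _ n k]) (auto simp: col_mult2[OF M frame_mat_carrier])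
    also have "\<dots> = (\<Sum>j<k. if j = i then c j else 0)"
      using w that by (intro sum.cong) (auto simp: orthonormal_family_def)
    also have "\<dots> = c i"
      using that by simp
    finally show ?thesis by simp
  qed
  with c(1) show False by auto
qed

section \<open>Frame matrices and the inverses they provide\<close>

lemma frame_mat_orthonormal:
  assumes M: "M \<in> carrier_mat n n" and w: "orthonormal_family n M k w"
  shows "(frame_mat n k w)\<^sup>H * M * frame_mat n k w = 1\<^sub>m k"
proof -
  let ?F = "frame_mat n k w"
  have wc: "w i \<in> carrier_vec n" if "i < k" for i
    using w that by (simp add: orthonormal_family_def)
  have "?F\<^sup>H * (M * ?F) = 1\<^sub>m k"
  proof (rule eq_matI)
    fix i j assume "i < dim_row (1\<^sub>m k :: quat mat)" "j < dim_col (1\<^sub>m k :: quat mat)"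
    then have ij: "i < k" "j < k" by auto
    have "(?F\<^sup>H * (M * ?F)) $$ (i, j) = (?F\<^sup>H *\<^sub>v col (M * ?F) j) $ i"
      using M ij by simp
    also have "\<dots> = cip (w i) (M *\<^sub>v w j)"
      using M ij wc
      by (subst adjoint_mult_vec_index[of _ n k]) (auto simp: col_mult2[OF M frame_mat_carrier])
    finally show "(?F\<^sup>H * (M * ?F)) $$ (i, j) = 1\<^sub>m k $$ (i, j)"
      using w ij by (simp add: orthonormal_family_def)
  qed (use M in \<open>auto simp: adjoint_quat_mat_def\<close>)
  then show ?thesis
    using M by (subst assoc_mult_mat[of _ k n _ n _ k]) auto
qed

text \<open>\<open>F^H M\<close> is a left inverse of \<open>F\<close>, hence also a right one;
  regrouping exhibits \<open>F F^H\<close> as the inverse of \<open>M\<close>.\<close>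

lemma orthonormal_frame_inverse:
  assumes M: "M \<in> carrier_mat n n" and F: "F \<in> carrier_mat n n" and "F\<^sup>H * M * F = 1\<^sub>m n"
  shows "F * F\<^sup>H * M = 1\<^sub>m n" "M * (F * F\<^sup>H) = 1\<^sub>m n"
proof -
  have "F * (F\<^sup>H * M) = 1\<^sub>m n"
    using assms by (intro quat_mat_mult_left_right_inverse[of "F\<^sup>H * M"]) auto
  then show 1: "F * F\<^sup>H * M = 1\<^sub>m n"
    using M F by (subst assoc_mult_mat[of _ n n _ n _ n]) auto
  show "M * (F * F\<^sup>H) = 1\<^sub>m n"
    using M F 1 by (intro quat_mat_mult_left_right_inverse[of "F * F\<^sup>H"]) auto
qed

text \<open>This resolves the definite description: a left inverse is two-sided, and any other
  inverse \<open>Y\<close> equals \<open>Y (N X) = X\<close>.\<close>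

lemma inv_quat_mat_eq:
  assumes N: "N \<in> carrier_mat n n" and X: "X \<in> carrier_mat n n" and XN: "X * N = 1\<^sub>m n"
  shows "inv_quat_mat N = X"
  unfolding inv_quat_mat_def
proof (rule the_equality)
  have NX: "N * X = 1\<^sub>m n"
    using quat_mat_mult_left_right_inverse[OF X N XN] .
  then show "X \<in> carrier_mat (dim_row N) (dim_row N) \<and> inverts_mat N X \<and> inverts_mat X N"
    using N X XN by (auto simp: inverts_mat_def)
  fix Y assume "Y \<in> carrier_mat (dim_row N) (dim_row N) \<and> inverts_mat N Y \<and> inverts_mat Y N"
  then have Y: "Y \<in> carrier_mat n n" "Y * N = 1\<^sub>m n"
    using N by (auto simp: inverts_mat_def)
  have "Y = Y * (N * X)"
    using Y NX by simp
  also have "\<dots> = X"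
    using Y X N by (subst assoc_mult_mat[of _ n n _ n _ n, symmetric]) auto
  finally show "Y = X" .
qed

text \<open>The entries of \<open>F^H v\<close> are the unweighted pairings
  \<open>cip (w i) v\<close>, and \<open>v = M F F^H v\<close> recovers \<open>v\<close> from
  them.\<close>

lemma orthonormal_family_ortho_all:
  assumes M: "M \<in> carrier_mat n n" and w: "orthonormal_family n M n w"
    and v: "v \<in> carrier_vec n" "\<And>i. i < n \<Longrightarrow> cip (w i) v = 0"
  shows "v = 0\<^sub>v n"
proof -
  let ?F = "frame_mat n n w"
  have wc: "w i \<in> carrier_vec n" if "i < n" for i
    using w that by (simp add: orthonormal_family_def)
  have "?F\<^sup>H *\<^sub>v v = 0\<^sub>v n"
    by (rule eq_vecI)
      (use v wc adjoint_mult_vec_index[OF frame_mat_carrier v(1), of _ n w] in auto)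
  moreover have "v = (M * (?F * ?F\<^sup>H)) *\<^sub>v v"
    using orthonormal_frame_inverse[OF M frame_mat_carrier frame_mat_orthonormal[OF M w]] v by simp
  moreover have "\<dots> = M *\<^sub>v (?F *\<^sub>v (?F\<^sup>H *\<^sub>v v))"
    using M v by (subst assoc_mult_mat_vec[of _ n n _ n], auto)
      (subst assoc_mult_mat_vec[of _ n n _ n], auto intro!: adjoint_carrier)
  ultimately show ?thesis
    using M by (simp add: mult_mat_vec_zero[of _ n n])
qed

text \<open>Once the first \<open>k\<close> eigenvectors are chosen, the compression of \<open>G\<close> to their
  \<open>N\<close>-orthogonal complement is Hermitian of order \<open>n - k\<close> and yields the next one.\<close>

lemma generalized_spectral_family:
  assumes N: "pos_def_quat_mat n N" and G: "G \<in> carrier_mat n n" "hermitian_quat_mat G"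
    and "k \<le> n"
  shows "\<exists>w (t :: nat \<Rightarrow> real). orthonormal_family n N k w \<and>
    (\<forall>i<k. G *\<^sub>v w i = (N *\<^sub>v w i) \<cdot>\<^sub>r of_real (t i))"
  using \<open>k \<le> n\<close>
proof (induction k)
  case 0
  show ?case by (simp add: orthonormal_family_def)
next
  case (Suc k)
  note Nc = pos_def_carrier[OF N]
  obtain w and t :: "nat \<Rightarrow> real" where w: "orthonormal_family n N k w"
    and Gw: "\<And>i. i < k \<Longrightarrow> G *\<^sub>v w i = (N *\<^sub>v w i) \<cdot>\<^sub>r of_real (t i)"
    using Suc by auto
  obtain w' where w': "orthonormal_family n N n w'" "\<And>i. i < k \<Longrightarrow> w' i = w i"
    using orthonormal_family_extend[OF N w] Suc.prems by auto
  have wc: "w' i \<in> carrier_vec n" if "i < n" for i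
    using w' that by (simp add: orthonormal_family_def)
  \<comment> \<open>The columns are the added basis vectors; they span the
    \<open>N\<close>-orthogonal complement of the first \<open>k\<close>.\<close>
  define Y where "Y = frame_mat n (n - k) (\<lambda>j. w' (k + j))"
  have Yc: "Y \<in> carrier_mat n (n - k)" by (simp add: Y_def)
  have Ycol: "col Y j = w' (k + j)" if "j < n - k" for j
    using that wc by (simp add: Y_def)
  define C where "C = Y\<^sup>H * (G * Y)"
  have Cc: "C \<in> carrier_mat (n - k) (n - k)"
    unfolding C_def by (rule mult_carrier_mat[of _ _ n]) (use Yc G in auto)
  have "C\<^sup>H = (G * Y)\<^sup>H * (Y\<^sup>H)\<^sup>H"
    unfolding C_def using Yc G by (intro adjoint_mult[of _ "n - k" n]) auto
  also have "\<dots> = Y\<^sup>H * G\<^sup>H * Y"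
    using Yc G by (simp add: adjoint_mult[of _ n n])
  also have "\<dots> = C"
    using Yc G by (simp add: C_def hermitian_quat_mat_def assoc_mult_mat[of _ "n - k" n _ n])
  finally have "hermitian_quat_mat C"
    by (simp add: hermitian_quat_mat_def)
  then obtain z s where z: "z \<in> carrier_vec (n - k)" "z \<noteq> 0\<^sub>v (n - k)" "C *\<^sub>v z = z \<cdot>\<^sub>r of_real s"
    using ex_real_eigenvalue_hermitian[OF Cc] Suc.prems by auto
  define y where "y = Y *\<^sub>v z"
  have yc: "y \<in> carrier_vec n" "N *\<^sub>v y \<in> carrier_vec n" "G *\<^sub>v y \<in> carrier_vec n"
    using Yc z Nc G by (auto simp: y_def)
  \<comment> \<open>The \<open>N\<close>-coordinates of \<open>y = Y z\<close> in the full basis are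
    \<open>z\<close> shifted by \<open>k\<close> places, preceded by zeros.\<close>
  have Ny: "cip (w' i) (N *\<^sub>v y) = (if i < k then 0 else z $ (i - k))" if i: "i < n" for i
  proof -
    have "cip (w' i) (N *\<^sub>v y) = cip (w' i) ((N * Y) *\<^sub>v z)"
      using Nc Yc z by (simp add: y_def assoc_mult_mat_vec[of _ n n _ "n - k"])
    also have "\<dots> = (\<Sum>j<n - k. cip (w' i) (col (N * Y) j) * z $ j)"
      by (rule cip_mult_mat_vec[OF mult_carrier_mat[OF Nc Yc] wc[OF i] z(1)])
    also have "\<dots> = (\<Sum>j<n - k. cip (w' i) (N *\<^sub>v w' (k + j)) * z $ j)"
      by (intro sum.cong refl) (simp only: col_mult2[OF Nc Yc] Ycol lessThan_iff)
    also have "\<dots> = (\<Sum>j<n - k. if i = k + j then z $ j else 0)"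
      using w'(1) i by (intro sum.cong) (auto simp: orthonormal_family_def)
    also have "\<dots> = (if i < k then 0 else z $ (i - k))"
    proof (cases "i < k")
      case False
      then have "(\<Sum>j<n - k. if i = k + j then z $ j else 0)
          = (\<Sum>j<n - k. if j = i - k then z $ j else 0)"
        by (intro sum.cong) auto
      moreover have "i - k < n - k" using False i by simp
      ultimately show ?thesis using False by simp
    qed (auto intro!: sum.neutral)
    finally show ?thesis .
  qed
  \<comment> \<open>For \<open>i < k\<close>, moving \<open>G\<close> onto the known eigenvector
    makes both sides vanish. Otherwise the left side is entry \<open>i - k\<close> of
    \<open>C z\<close>, where the eigenvector equation of \<open>C\<close> applies.\<close>
  have Gy: "cip (w' i) (G *\<^sub>v y) = cip (w' i) (N *\<^sub>v y) * of_real s" if i: "i < n" for i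
  proof (cases "i < k")
    case True
    have "cip (w' i) (G *\<^sub>v y) = cip ((N *\<^sub>v w' i) \<cdot>\<^sub>r of_real (t i)) y"
      using cip_hermitian[OF G wc[OF i] yc(1)] Gw[OF True] w'(2)[OF True] by simp
    also have "\<dots> = of_real (t i) * cip (w' i) (N *\<^sub>v y)"
      using cip_hermitian[OF Nc pos_def_hermitian[OF N] wc[OF i] yc(1)] Nc wc[OF i] yc
      by (subst cip_smult_left[of _ n]) auto
    finally show ?thesis
      using Ny[OF i] True by simp
  next
    case False
    with i have ik: "i - k < n - k" "k + (i - k) = i" by auto
    have "cip (w' i) (G *\<^sub>v y) = (Y\<^sup>H *\<^sub>v (G *\<^sub>v y)) $ (i - k)"
      using adjoint_mult_vec_index[OF Yc yc(3) ik(1)] Ycol[OF ik(1)] ik(2) by simp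
    also have "Y\<^sup>H *\<^sub>v (G *\<^sub>v y) = C *\<^sub>v z"
      using Yc G z(1)
      by (simp add: C_def y_def assoc_mult_mat_vec[of _ "n - k" n _ "n - k"]
          assoc_mult_mat_vec[of _ n n _ "n - k"])
    finally show ?thesis
      using Ny[OF i] False z ik by simp
  qed
  \<comment> \<open>The difference pairs to zero with every basis vector, which turns the compressed
    equation into one in the whole space.\<close>
  have "G *\<^sub>v y - (N *\<^sub>v y) \<cdot>\<^sub>r of_real s = 0\<^sub>v n"
  proof (rule orthonormal_family_ortho_all[OF Nc w'(1)])
    show "G *\<^sub>v y - (N *\<^sub>v y) \<cdot>\<^sub>r of_real s \<in> carrier_vec n"
      using yc by auto
    fix i assume i: "i < n"
    have "cip (w' i) (G *\<^sub>v y - (N *\<^sub>v y) \<cdot>\<^sub>r of_real s)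
        = cip (w' i) (G *\<^sub>v y) - cip (w' i) ((N *\<^sub>v y) \<cdot>\<^sub>r of_real s)"
      using wc[OF i] yc by (intro cip_diff_right) auto
    then show "cip (w' i) (G *\<^sub>v y - (N *\<^sub>v y) \<cdot>\<^sub>r of_real s) = 0"
      using Gy[OF i] wc[OF i] yc by (simp add: cip_smult_right[of _ n])
  qed
  then have Gy': "G *\<^sub>v y = (N *\<^sub>v y) \<cdot>\<^sub>r of_real s"
    using yc G(1) by (auto simp: vec_eq_iff)
  have "y \<noteq> 0\<^sub>v n"
  proof
    assume "y = 0\<^sub>v n"
    then have "N *\<^sub>v y = 0\<^sub>v n" using Nc by (simp add: mult_mat_vec_zero)
    then have "z $ j = 0" if "j < n - k" for j
      using Ny[of "k + j"] wc[of "k + j"] that by auto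
    then show False using z by (auto simp: vec_eq_iff)
  qed
  moreover have "cip (w i) (N *\<^sub>v y) = 0" if "i < k" for i
    using Ny[of i] w'(2)[OF that] that Suc.prems by simp
  ultimately obtain c :: real
    where c: "orthonormal_family n N (Suc k) (w(k := y \<cdot>\<^sub>r of_real c))"
    using orthonormal_family_append[OF N w yc(1)] by blast
  \<comment> \<open>Rescaling preserves the equation because the real factors \<open>c\<close> and
    \<open>s\<close> commute.\<close>
  have "G *\<^sub>v (y \<cdot>\<^sub>r of_real c) = (N *\<^sub>v (y \<cdot>\<^sub>r of_real c)) \<cdot>\<^sub>r of_real s"
    using yc G Nc Gy'
    by (simp add: mult_mat_vec_smult_right[of _ n n] smult_right_smult_right
        of_real_mult_commute[of c "of_real s"])
  then have "\<forall>i<Suc k. G *\<^sub>v (w(k := y \<cdot>\<^sub>r of_real c)) i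
      = (N *\<^sub>v (w(k := y \<cdot>\<^sub>r of_real c)) i) \<cdot>\<^sub>r of_real ((t(k := s)) i)"
    using Gw by (auto simp: less_Suc_eq)
  with c show ?case by blast
qed

section \<open>Eigenvalues of diagonalizable matrices\<close>

lemma order_prod_linear:
  fixes c :: "'i \<Rightarrow> 'a :: idom"
  assumes "finite S"
  shows "order t (\<Prod>i\<in>S. [:- c i, 1:]) = card {i \<in> S. c i = t}"
  using assms
proof (induction S rule: finite_induct)
  case (insert k S)
  have lin: "order t [:- c k, 1:] = (if c k = t then 1 else 0)"
  proof (cases "c k = t")
    case True
    then have "order t [:- c k, 1:] \<noteq> 0"
      by (simp add: order_root[of _ t, THEN iffD1])
    moreover have "order t [:- c k, 1:] \<le> 1"
      using order_degree[of "[:- c k, 1:]" t] by simp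
    ultimately show ?thesis using True by simp
  next
    case False
    then show ?thesis by (simp add: order_0I)
  qed
  have set: "{i \<in> Set.insert k S. c i = t}
      = (if c k = t then Set.insert k {i \<in> S. c i = t} else {i \<in> S. c i = t})"
    by auto
  have "(\<Prod>i\<in>S. [:- c i, 1:]) \<noteq> 0"
    using insert.hyps by simp
  then have "order t (\<Prod>i\<in>Set.insert k S. [:- c i, 1:])
      = order t [:- c k, 1:] + order t (\<Prod>i\<in>S. [:- c i, 1:])"
    using insert.hyps order_mult[of "[:- c k, 1:]" "\<Prod>i\<in>S. [:- c i, 1:]" t]
    by (simp del: mult_pCons_left)
  also have "\<dots> = card {i \<in> Set.insert k S. c i = t}"
    unfolding set lin insert.IH using insert.hyps by simp
  finally show ?case .
qed simp

text \<open>Each diagonal entry occurs once in either diagonal block. The resulting square is what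
  the halving in \<open>real_eigenvalue_mult\<close> undoes.\<close>

lemma char_poly_complex_adjoint_diag:
  "char_poly (complex_adjoint_mat (mat_diag n (\<lambda>i. of_real (d i))))
     = (\<Prod>i<n. [:- of_real (d i), 1:]) ^ 2"
proof -
  let ?D = "mat_diag n (\<lambda>i. complex_of_real (d i))"
  let ?C = "four_block_mat ?D (0\<^sub>m n n) (0\<^sub>m n n) ?D"
  have "upper_triangular ?D"
    by (auto simp: mat_diag_def)
  then have "upper_triangular ?C"
    by (intro upper_triangular_four_block[of _ n _ n]) auto
  then have "char_poly ?C = (\<Prod>a\<leftarrow>diag_mat ?C. [:- a, 1:])"
    by (intro char_poly_upper_triangular[of _ "n + n"]) auto
  also have "diag_mat ?C = diag_mat ?D @ diag_mat ?D"
    by (rule diag_four_block_mat[of _ n _ n]) auto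
  also have "diag_mat ?D = map (\<lambda>i. of_real (d i)) [0..<n]"
    by (auto simp: diag_mat_def mat_diag_def)
  finally show ?thesis
    by (simp add: complex_adjoint_diag o_def power2_eq_square lessThan_atLeast0
        flip: prod.distinct_set_conv_list)
qed

lemma mat_diag_mult_vec:
  "z \<in> carrier_vec n \<Longrightarrow> mat_diag n f *\<^sub>v z = vec n (\<lambda>i. f i * z $ i)"
proof (rule eq_vecI)
  fix i assume z: "z \<in> carrier_vec n" and "i < dim_vec (vec n (\<lambda>i. f i * z $ i))"
  then have i: "i < n" by simp
  have "(mat_diag n f *\<^sub>v z) $ i = (\<Sum>j<n. (if i = j then f j else 0) * z $ j)"
    using z i by (simp add: mat_diag_def scalar_prod_def lessThan_atLeast0)
  also have "\<dots> = (\<Sum>j<n. if j = i then f i * z $ i else 0)"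
    by (intro sum.cong) auto
  finally have "(mat_diag n f *\<^sub>v z) $ i = (\<Sum>j<n. if j = i then f i * z $ i else 0)" .
  then show "(mat_diag n f *\<^sub>v z) $ i = vec n (\<lambda>i. f i * z $ i) $ i"
    using i by simp
qed (simp add: mat_diag_def)

text \<open>Here \<open>B = X D Y\<close> with \<open>Y\<close> inverse to \<open>X\<close>.
  Substituting \<open>x = X y\<close> reduces eigenvectors to those of the diagonal
  \<open>D\<close>, and multiplicities are read off from the similar complex adjoints.\<close>

lemma lists_nonzero_eigenvalues_diag:
  assumes B: "B \<in> carrier_mat n n" and X: "X \<in> carrier_mat n n" and Y: "Y \<in> carrier_mat n n"
    and YX: "Y * X = 1\<^sub>m n"
    and BX: "B * X = X * mat_diag n (\<lambda>i. of_real (if i < r then \<mu> i else 0))"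
    and r: "r \<le> n" "\<And>i. i < r \<Longrightarrow> \<mu> i \<noteq> 0"
  shows "lists_nonzero_eigenvalues B r \<mu>"
proof -
  define d where "d i = (if i < r then \<mu> i else 0)" for i
  let ?D = "mat_diag n (\<lambda>i. of_real (d i)) :: quat mat"
  have BX: "B * X = X * ?D" using BX by (simp add: d_def)
  have XY: "X * Y = 1\<^sub>m n"
    using quat_mat_mult_left_right_inverse[OF Y X YX] .
  have BXv: "B *\<^sub>v (X *\<^sub>v z) = X *\<^sub>v (?D *\<^sub>v z)" if "z \<in> carrier_vec n" for z
    using that B X arg_cong[OF BX, of "\<lambda>Z. Z *\<^sub>v z"]
    by (simp add: assoc_mult_mat_vec[of _ n n _ n])
  have YXv: "Y *\<^sub>v (X *\<^sub>v z) = z" if "z \<in> carrier_vec n" for z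
    using that Y X arg_cong[OF YX, of "\<lambda>Z. Z *\<^sub>v z"] by (simp add: assoc_mult_mat_vec[of _ n n _ n])
  have XYv: "X *\<^sub>v (Y *\<^sub>v z) = z" if "z \<in> carrier_vec n" for z
    using that Y X arg_cong[OF XY, of "\<lambda>Z. Z *\<^sub>v z"] by (simp add: assoc_mult_mat_vec[of _ n n _ n])
  have "right_eigenvalue B l \<and> l \<noteq> 0 \<longleftrightarrow> (\<exists>i<r. l = of_real (\<mu> i))" for l
  proof
    assume "right_eigenvalue B l \<and> l \<noteq> 0"
    then obtain x where x: "x \<in> carrier_vec n" "x \<noteq> 0\<^sub>v n" "B *\<^sub>v x = x \<cdot>\<^sub>r l" and "l \<noteq> 0"
      using B by (auto simp: right_eigenvalue_def)
    define y where "y = Y *\<^sub>v x"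
    have y: "y \<in> carrier_vec n" "x = X *\<^sub>v y"
      using Y x XYv by (auto simp: y_def)
    have Dy: "?D *\<^sub>v y \<in> carrier_vec n"
      using y by (auto intro!: mult_mat_vec_carrier[of _ n n])
    have "?D *\<^sub>v y = Y *\<^sub>v (X *\<^sub>v (?D *\<^sub>v y))"
      using YXv[OF Dy] by simp
    also have "\<dots> = Y *\<^sub>v (x \<cdot>\<^sub>r l)"
      using BXv[OF y(1)] y(2) x(3) by simp
    also have "\<dots> = y \<cdot>\<^sub>r l"
      using Y x(1) by (simp add: mult_mat_vec_smult_right y_def)
    finally have Dyl: "?D *\<^sub>v y = y \<cdot>\<^sub>r l" .
    have "y \<noteq> 0\<^sub>v n"
      using x y X mult_mat_vec_zero by metis
    then obtain i where i: "i < n" "y $ i \<noteq> 0"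
      using y(1) by (auto simp: vec_eq_iff)
    have "of_real (d i) * y $ i = y $ i * l"
      using arg_cong[OF Dyl, of "\<lambda>v. v $ i"] y(1) i(1) by (simp add: mat_diag_mult_vec)
    \<comment> \<open>A real diagonal entry commutes with the coordinate, so cancelling on the left
      gives \<open>l\<close> itself and not just a conjugate of it.\<close>
    then have "y $ i * of_real (d i) = y $ i * l"
      by (simp add: of_real_mult_commute[of _ "y $ i"])
    then have "l = of_real (d i)"
      using i(2) by simp
    then show "\<exists>i<r. l = of_real (\<mu> i)"
      using \<open>l \<noteq> 0\<close> by (auto simp: d_def split: if_splits)
  next
    assume "\<exists>i<r. l = of_real (\<mu> i)"
    then obtain i where i: "i < r" "l = of_real (\<mu> i)" by blast
    define e where "e = (unit_vec n i :: quat vec)"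
    have e: "e \<in> carrier_vec n" "e \<noteq> 0\<^sub>v n"
      using i r by (auto simp: e_def vec_eq_iff unit_vec_def)
    have "?D *\<^sub>v e = e \<cdot>\<^sub>r l"
      by (rule eq_vecI) (use i r e(1) in \<open>auto simp: mat_diag_mult_vec e_def unit_vec_def d_def\<close>)
    then have "B *\<^sub>v (X *\<^sub>v e) = (X *\<^sub>v e) \<cdot>\<^sub>r l"
      using BXv[OF e(1)] e(1) X by (simp add: mult_mat_vec_smult_right)
    moreover have "X *\<^sub>v e \<noteq> 0\<^sub>v n"
      using YXv[OF e(1)] e(2) Y mult_mat_vec_zero by metis
    moreover have "X *\<^sub>v e \<in> carrier_vec n"
      using X e by auto
    ultimately show "right_eigenvalue B l \<and> l \<noteq> 0"
      using B i r by (auto simp: right_eigenvalue_def)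
  qed
  then have "{l. right_eigenvalue B l \<and> l \<noteq> 0} = (\<lambda>i. of_real (\<mu> i)) ` {..<r}"
    by auto
  moreover have "real_eigenvalue_mult B t = card {i \<in> {..<r}. \<mu> i = t}" if "t \<noteq> 0" for t
  proof -
    have "B = B * (X * Y)" using B XY by simp
    also have "\<dots> = X * ?D * Y"
      using B X Y by (simp add: assoc_mult_mat[of _ n n _ n _ n, symmetric] BX)
    finally have "complex_adjoint_mat B
        = complex_adjoint_mat X * complex_adjoint_mat ?D * complex_adjoint_mat Y"
      using X Y by (simp add: complex_adjoint_mult[of _ n n _ n])
    moreover have "complex_adjoint_mat X * complex_adjoint_mat Y = 1\<^sub>m (n + n)"
      "complex_adjoint_mat Y * complex_adjoint_mat X = 1\<^sub>m (n + n)"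
      using X Y XY YX by (simp_all add: complex_adjoint_one flip: complex_adjoint_mult[of _ n n _ n])
    ultimately have "similar_mat_wit (complex_adjoint_mat B) (complex_adjoint_mat ?D)
        (complex_adjoint_mat X) (complex_adjoint_mat Y)"
      using complex_adjoint_carrier[OF B] complex_adjoint_carrier[OF X]
        complex_adjoint_carrier[OF Y] complex_adjoint_carrier[OF mat_diag_dim]
      by (auto simp: similar_mat_wit_def Let_def)
    then have "char_poly (complex_adjoint_mat B) = (\<Prod>i<n. [:- of_real (d i), 1:]) ^ 2"
      using char_poly_similar char_poly_complex_adjoint_diag unfolding similar_mat_def by metis
    moreover have "(\<Prod>i<n. [:- complex_of_real (d i), 1:]) \<noteq> 0"
      by simp
    ultimately have "real_eigenvalue_mult B t = card {i \<in> {..<n}. d i = t}"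
      by (simp add: real_eigenvalue_mult_def power2_eq_square order_mult order_prod_linear)
    \<comment> \<open>The padding zeros of \<open>d\<close> are not counted, since \<open>t\<close>
      is nonzero.\<close>
    also have "{i \<in> {..<n}. d i = t} = {i \<in> {..<r}. \<mu> i = t}"
      using r that by (auto simp: d_def)
    finally show ?thesis .
  qed
  ultimately show ?thesis
    by (simp add: lists_nonzero_eigenvalues_def)
qed

section \<open>Rank of a matrix in diagonal form\<close>

lemma sigma_block_carrier:
  "r \<le> m \<Longrightarrow> r \<le> n \<Longrightarrow> sigma_block_mat m n r \<sigma> \<in> carrier_mat m n"
  using four_block_carrier_mat[OF mat_diag_dim zero_carrier_mat, of r "\<lambda>i. of_real (\<sigma> i)"]
  unfolding sigma_block_mat_def by (metis le_add_diff_inverse)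

lemma sigma_block_index:
  "r \<le> m \<Longrightarrow> r \<le> n \<Longrightarrow> i < m \<Longrightarrow> j < n \<Longrightarrow>
    sigma_block_mat m n r \<sigma> $$ (i, j) = (if i = j \<and> i < r then of_real (\<sigma> i) else 0)"
  by (simp add: sigma_block_mat_def mat_diag_def)

lemma sigma_block_mult_vec:
  assumes r: "r \<le> m" "r \<le> n" and z: "z \<in> carrier_vec n"
  shows "sigma_block_mat m n r \<sigma> *\<^sub>v z = vec m (\<lambda>i. if i < r then of_real (\<sigma> i) * z $ i else 0)"
proof -
  define D where "D = sigma_block_mat m n r \<sigma>"
  have D: "D \<in> carrier_mat m n"
    unfolding D_def using r by (rule sigma_block_carrier)
  have "(D *\<^sub>v z) $ i = (if i < r then of_real (\<sigma> i) * z $ i else 0)" if i: "i < m" for i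
  proof -
    have "(D *\<^sub>v z) $ i = (\<Sum>j<n. D $$ (i, j) * z $ j)"
      using D i z by (auto simp: scalar_prod_def lessThan_atLeast0 intro!: sum.cong)
    also have "\<dots> = (\<Sum>j<n. if j = i then (if i < r then of_real (\<sigma> i) * z $ i else 0) else 0)"
      unfolding D_def by (intro sum.cong refl) (simp add: sigma_block_index[OF r i])
    also have "\<dots> = (if i < r then of_real (\<sigma> i) * z $ i else 0)"
      using r(2) by simp
    finally show ?thesis .
  qed
  then have "D *\<^sub>v z = vec m (\<lambda>i. if i < r then of_real (\<sigma> i) * z $ i else 0)"
    using D by (intro eq_vecI) auto
  then show ?thesis by (simp add: D_def)
qed

text \<open>Independence of \<open>J\<close> forces the coefficient of column \<open>j\<close> in a
  dependence to be nonzero, so the relation can be divided by it from the right.\<close>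

lemma ex_col_combination:
  assumes "right_indep_cols A J" "finite J" "\<not> right_indep_cols A (insert j J)"
  shows "\<exists>c. \<forall>i<dim_row A. A $$ (i, j) = (\<Sum>l\<in>J. A $$ (i, l) * c l)"
proof -
  have j: "j \<notin> J"
    using assms by (auto simp: insert_absorb)
  obtain c where c: "\<And>i. i < dim_row A \<Longrightarrow> (\<Sum>l\<in>insert j J. A $$ (i, l) * c l) = 0"
    "\<exists>l\<in>insert j J. c l \<noteq> 0"
    using assms(3) by (auto simp: right_indep_cols_def)
  have cj: "c j \<noteq> 0"
  proof
    assume "c j = 0"
    then have "(\<Sum>l\<in>J. A $$ (i, l) * c l) = 0" if "i < dim_row A" for i
      using c(1)[OF that] assms(2) j by simp
    then have "\<forall>l\<in>J. c l = 0"
      using assms(1) by (simp add: right_indep_cols_def)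
    with c(2) \<open>c j = 0\<close> show False by auto
  qed
  have "A $$ (i, j) = (\<Sum>l\<in>J. A $$ (i, l) * (- c l * inverse (c j)))" if "i < dim_row A" for i
  proof -
    have "A $$ (i, j) * c j = - (\<Sum>l\<in>J. A $$ (i, l) * c l)"
      using c(1)[OF that] assms(2) j by (simp add: eq_neg_iff_add_eq_0)
    then have "A $$ (i, j) * c j * inverse (c j) = (\<Sum>l\<in>J. A $$ (i, l) * (- c l)) * inverse (c j)"
      by (simp add: sum_negf)
    then show ?thesis
      using cj by (simp add: mult.assoc sum_distrib_right)
  qed
  then show ?thesis by (intro exI[of _ "\<lambda>l. - c l * inverse (c j)"] allI impI)
qed

text \<open>Both bounds use underdetermined systems. More than \<open>r\<close> columns admit a
  nontrivial combination \<open>v\<close> with the first \<open>r\<close> entries of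
  \<open>W' v\<close> zero, so \<open>A v = U D W' v = 0\<close>. Fewer than \<open>r\<close>
  spanning columns would give a nonzero \<open>z\<close>, supported on the first \<open>r\<close>
  places, with \<open>U D z = A W z = 0\<close>, although \<open>U\<close> is injective and
  \<open>D\<close> is nonsingular there.\<close>

lemma rank_quat_mat_eqI:
  assumes A: "A \<in> carrier_mat m n" and U: "U \<in> carrier_mat m m" and U': "U' \<in> carrier_mat m m"
    and W: "W \<in> carrier_mat n n" and W': "W' \<in> carrier_mat n n"
    and U'U: "U' * U = 1\<^sub>m m" and WW': "W * W' = 1\<^sub>m n" and r: "r \<le> m" "r \<le> n"
    and \<sigma>: "\<And>i. i < r \<Longrightarrow> \<sigma> i \<noteq> 0"
    and AW: "A * W = U * sigma_block_mat m n r \<sigma>"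
  shows "rank_quat_mat A = r"
proof -
  define D where "D = sigma_block_mat m n r \<sigma>"
  have D: "D \<in> carrier_mat m n"
    unfolding D_def using r by (rule sigma_block_carrier)
  have AW: "A * W = U * D"
    using AW by (simp add: D_def)
  have Dvec: "D *\<^sub>v z = vec m (\<lambda>i. if i < r then of_real (\<sigma> i) * z $ i else 0)"
    if "z \<in> carrier_vec n" for z
    unfolding D_def using r that by (rule sigma_block_mult_vec)
  have AWv: "A *\<^sub>v (W *\<^sub>v z) = U *\<^sub>v (D *\<^sub>v z)" if "z \<in> carrier_vec n" for z
  proof -
    have "(A * W) *\<^sub>v z = (U * D) *\<^sub>v z" by (simp add: AW)
    then show ?thesis
      using that A W U D by (simp add: assoc_mult_mat_vec[of _ m n _ n] assoc_mult_mat_vec[of _ m m _ n])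
  qed
  have upper: "card J \<le> r" if J: "J \<subseteq> {..<n}" "right_indep_cols A J" for J
  proof (rule ccontr)
    assume "\<not> card J \<le> r"
    moreover have fin: "finite J" using J(1) finite_subset by blast
    ultimately obtain c where c: "\<exists>j\<in>J. c j \<noteq> 0" "\<And>i. i < r \<Longrightarrow> (\<Sum>j\<in>J. W' $$ (i, j) * c j) = 0"
      using homogeneous_system_nontrivial[of "{..<r}" J "\<lambda>i j. W' $$ (i, j)"] by auto
    define v where "v = vec n (\<lambda>j. if j \<in> J then c j else 0)"
    have vc: "v \<in> carrier_vec n" by (simp add: v_def)
    have mv: "(E *\<^sub>v v) $ i = (\<Sum>j\<in>J. E $$ (i, j) * c j)"
      if "E \<in> carrier_mat p n" "i < p" for E p i
    proof -
      have "(E *\<^sub>v v) $ i = (\<Sum>j<n. if j \<in> J then E $$ (i, j) * c j else 0)"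
        using that by (auto simp: v_def scalar_prod_def lessThan_atLeast0 intro!: sum.cong)
      also have "\<dots> = (\<Sum>j\<in>J. E $$ (i, j) * c j)"
        using J(1) by (subst sum.inter_restrict[symmetric]) (auto simp: Int_absorb1)
      finally show ?thesis .
    qed
    have W'v: "W' *\<^sub>v v \<in> carrier_vec n" using W' vc by auto
    have "D *\<^sub>v (W' *\<^sub>v v) = 0\<^sub>v m"
    proof (rule eq_vecI)
      fix i assume "i < dim_vec (0\<^sub>v m :: quat vec)"
      then show "(D *\<^sub>v (W' *\<^sub>v v)) $ i = 0\<^sub>v m $ i"
        using mv[OF W'] c(2) r by (simp add: Dvec[OF W'v] del: index_mult_mat_vec)
    qed (use D in auto)
    then have "A *\<^sub>v (W *\<^sub>v (W' *\<^sub>v v)) = 0\<^sub>v m"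
      using AWv[OF W'v] U by (simp add: mult_mat_vec_zero)
    moreover have "W *\<^sub>v (W' *\<^sub>v v) = v"
      using assoc_mult_mat_vec[OF W W' vc] WW' vc by simp
    ultimately have "(\<Sum>j\<in>J. A $$ (i, j) * c j) = 0" if "i < m" for i
      using mv[OF A that] that by simp
    then have "\<forall>j\<in>J. c j = 0"
      using J(2) A by (auto simp: right_indep_cols_def)
    with c(1) show False by blast
  qed
  let ?S = "{card J |J. J \<subseteq> {..<dim_col A} \<and> right_indep_cols A J}"
  have fin: "finite ?S"
    by (rule finite_subset[of _ "{..r}"]) (use upper A in auto)
  have "right_indep_cols A {}"
    by (simp add: right_indep_cols_def)
  then have "?S \<noteq> {}" by blast
  then obtain J where J: "J \<subseteq> {..<n}" "right_indep_cols A J" "card J = Max ?S"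
    using Max_in[OF fin] A by auto
  have finJ: "finite J" using J(1) finite_subset by blast
  have "\<not> card J < r"
  proof
    assume less: "card J < r"
    \<comment> \<open>By maximality of \<open>J\<close>, every column of \<open>A\<close> is a right
      combination of the columns in \<open>J\<close>.\<close>
    have "\<exists>c. \<forall>i<m. A $$ (i, j) = (\<Sum>l\<in>J. A $$ (i, l) * c l)" if "j < n" for j
    proof (cases "j \<in> J")
      case True
      have "A $$ (i, j) = (\<Sum>l\<in>J. A $$ (i, l) * (if l = j then 1 else 0))" for i
      proof -
        have "(\<Sum>l\<in>J. A $$ (i, l) * (if l = j then 1 else 0)) = (\<Sum>l\<in>J. if l = j then A $$ (i, j) else 0)"
          by (intro sum.cong) auto
        then show ?thesis using True finJ by simp
      qed
      then show ?thesis
        by (intro exI[of _ "\<lambda>l. if l = j then 1 else 0"] allI impI)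
    next
      case False
      have "\<not> right_indep_cols A (insert j J)"
      proof
        assume "right_indep_cols A (insert j J)"
        then have "card (insert j J) \<in> ?S"
          using J(1) that A by auto
        then have "card (insert j J) \<le> card J"
          using Max_ge[OF fin] J(3) by simp
        then show False using False finJ by simp
      qed
      then show ?thesis
        using ex_col_combination[OF J(2) finJ] A by auto
    qed
    then obtain C where C: "\<And>i j. j < n \<Longrightarrow> i < m \<Longrightarrow> A $$ (i, j) = (\<Sum>l\<in>J. A $$ (i, l) * C j l)"
      by metis
    \<comment> \<open>With \<open>C\<close> as coefficient matrix, \<open>A\<close> factors through
      the \<open>card J\<close> coordinates indexed by \<open>J\<close>. Requiring these coordinates
      of \<open>W z\<close> to vanish gives \<open>card J\<close> equations in \<open>r\<close>
      unknowns.\<close>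
    obtain c where c: "\<exists>j\<in>{..<r}. c j \<noteq> 0"
      "\<And>l. l \<in> J \<Longrightarrow> (\<Sum>j<r. (\<Sum>p<n. C p l * W $$ (p, j)) * c j) = 0"
      using homogeneous_system_nontrivial[of J "{..<r}" "\<lambda>l j. \<Sum>p<n. C p l * W $$ (p, j)"]
        finJ less by auto
    define z where "z = vec n (\<lambda>j. if j < r then c j else 0)"
    have zc: "z \<in> carrier_vec n" by (simp add: z_def)
    have Wz: "(W *\<^sub>v z) $ p = (\<Sum>j<r. W $$ (p, j) * c j)" if "p < n" for p
    proof -
      have "(W *\<^sub>v z) $ p = (\<Sum>j<n. if j \<in> {..<r} then W $$ (p, j) * c j else 0)"
        using that W by (auto simp: z_def scalar_prod_def lessThan_atLeast0 intro!: sum.cong)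
      also have "\<dots> = (\<Sum>j<r. W $$ (p, j) * c j)"
        using r(2) by (subst sum.inter_restrict[symmetric]) (auto intro!: sum.cong)
      finally show ?thesis .
    qed
    have 0: "(\<Sum>p<n. C p l * (W *\<^sub>v z) $ p) = 0" if "l \<in> J" for l
    proof -
      have "(\<Sum>p<n. C p l * (W *\<^sub>v z) $ p) = (\<Sum>p<n. \<Sum>j<r. C p l * W $$ (p, j) * c j)"
        by (intro sum.cong) (auto simp: Wz sum_distrib_left mult.assoc simp del: index_mult_mat_vec)
      also have "\<dots> = (\<Sum>j<r. \<Sum>p<n. C p l * W $$ (p, j) * c j)"
        by (rule sum.swap)
      finally show ?thesis
        using c(2)[OF that] by (simp add: sum_distrib_right)
    qed
    have "A *\<^sub>v (W *\<^sub>v z) = 0\<^sub>v m"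
    proof (rule eq_vecI)
      fix i assume "i < dim_vec (0\<^sub>v m :: quat vec)"
      then have i: "i < m" by simp
      have "(A *\<^sub>v (W *\<^sub>v z)) $ i = (\<Sum>p<n. A $$ (i, p) * (W *\<^sub>v z) $ p)"
        using A W i by (auto simp: scalar_prod_def lessThan_atLeast0 intro!: sum.cong)
      also have "\<dots> = (\<Sum>p<n. \<Sum>l\<in>J. A $$ (i, l) * (C p l * (W *\<^sub>v z) $ p))"
        by (intro sum.cong) (auto simp: C[OF _ i] sum_distrib_right mult.assoc simp del: index_mult_mat_vec)
      also have "\<dots> = (\<Sum>l\<in>J. \<Sum>p<n. A $$ (i, l) * (C p l * (W *\<^sub>v z) $ p))"
        by (rule sum.swap)
      also have "\<dots> = (\<Sum>l\<in>J. A $$ (i, l) * (\<Sum>p<n. C p l * (W *\<^sub>v z) $ p))"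
        by (simp add: sum_distrib_left)
      also have "\<dots> = 0"
        using 0 by simp
      finally show "(A *\<^sub>v (W *\<^sub>v z)) $ i = 0\<^sub>v m $ i"
        using i by simp
    qed (use A in auto)
    then have UDz: "U *\<^sub>v (D *\<^sub>v z) = 0\<^sub>v m"
      using AWv[OF zc] by simp
    have Dz: "D *\<^sub>v z \<in> carrier_vec m"
      using D zc by auto
    have "D *\<^sub>v z = U' *\<^sub>v (U *\<^sub>v (D *\<^sub>v z))"
      using assoc_mult_mat_vec[OF U' U Dz] U'U Dz by simp
    also have "\<dots> = 0\<^sub>v m"
      using UDz U' by (simp add: mult_mat_vec_zero)
    finally have Dz0: "D *\<^sub>v z = 0\<^sub>v m" .
    have "c j = 0" if "j < r" for j
    proof -
      have "0 = (D *\<^sub>v z) $ j"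
        unfolding Dz0 using that r by simp
      also have "\<dots> = of_real (\<sigma> j) * c j"
        unfolding Dvec[OF zc] using that r by (simp add: z_def)
      finally show ?thesis
        using \<sigma>[OF that] by simp
    qed
    with c(1) show False by auto
  qed
  then show ?thesis
    using upper[OF J(1,2)] J(3) by (simp add: rank_quat_mat_def)
qed

section \<open>The weighted singular value decomposition\<close>

text \<open>\<open>sort_key\<close> sorts increasingly, hence the negated key.\<close>

lemma ex_antimono_reordering:
  fixes t :: "nat \<Rightarrow> 'a :: linordered_ab_group_add"
  shows "\<exists>p. bij_betw p {..<n} {..<n} \<and> (\<forall>i j. i \<le> j \<and> j < n \<longrightarrow> t (p j) \<le> t (p i))"
proof -
  define xs where "xs = sort_key (\<lambda>i. - t i) [0..<n]"
  have xs: "distinct xs" "set xs = {..<n}" "length xs = n" "sorted (map (\<lambda>i. - t i) xs)"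
    by (auto simp: xs_def)
  have "bij_betw ((!) xs) {..<n} {..<n}"
    using bij_betw_nth[OF xs(1)] xs(2,3) by auto
  moreover have "t (xs ! j) \<le> t (xs ! i)" if "i \<le> j" "j < n" for i j
    using sorted_nth_mono[OF xs(4), of i j] that xs(3) by simp
  ultimately show ?thesis by blast
qed

section \<open>Products and adjoints of the rectangular diagonal block\<close>

lemma sigma_block_right_mult_index:
  assumes "r \<le> m" "r \<le> n" "U \<in> carrier_mat m m" "i < m" "j < n"
  shows "(U * sigma_block_mat m n r \<sigma>) $$ (i, j) = (if j < r then U $$ (i, j) * of_real (\<sigma> j) else 0)"
proof -
  define D where "D = sigma_block_mat m n r \<sigma>"
  have D: "D \<in> carrier_mat m n"
    unfolding D_def using assms(1,2) by (rule sigma_block_carrier)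
  have "(U * D) $$ (i, j) = (\<Sum>l<m. U $$ (i, l) * D $$ (l, j))"
    using assms D by (simp add: scalar_prod_def lessThan_atLeast0)
  also have "\<dots> = (\<Sum>l<m. if l = j then (if j < r then U $$ (i, j) * of_real (\<sigma> j) else 0) else 0)"
    unfolding D_def by (intro sum.cong refl) (use assms in \<open>simp add: sigma_block_index\<close>)
  also have "\<dots> = (if j < r then U $$ (i, j) * of_real (\<sigma> j) else 0)"
    using assms(1) by simp
  finally show ?thesis by (simp add: D_def)
qed

lemma adjoint_sigma_block:
  assumes "r \<le> m" "r \<le> n"
  shows "(sigma_block_mat m n r \<sigma>)\<^sup>H = sigma_block_mat n m r \<sigma>"
proof (rule eq_matI)
  fix i j assume "i < dim_row (sigma_block_mat n m r \<sigma>)" "j < dim_col (sigma_block_mat n m r \<sigma>)"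
  then have "i < n" "j < m"
    using carrier_matD[OF sigma_block_carrier[OF assms(2,1), of \<sigma>]] by auto
  then show "(sigma_block_mat m n r \<sigma>)\<^sup>H $$ (i, j) = sigma_block_mat n m r \<sigma> $$ (i, j)"
    using assms by (simp add: adjoint_index[OF sigma_block_carrier] sigma_block_index)
qed (simp_all only: adjoint_dims carrier_matD[OF sigma_block_carrier[OF assms(1,2), of \<sigma>]]
    carrier_matD[OF sigma_block_carrier[OF assms(2,1), of \<sigma>]])

lemma sigma_block_mult_sigma_block:
  assumes "r \<le> m" "r \<le> n"
  shows "sigma_block_mat m n r \<sigma> * sigma_block_mat n m r \<sigma>
    = mat_diag m (\<lambda>i. of_real (if i < r then (\<sigma> i)\<^sup>2 else 0))"
proof -
  define D where "D = sigma_block_mat m n r \<sigma>"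
  define E where "E = sigma_block_mat n m r \<sigma>"
  have D: "D \<in> carrier_mat m n" and E: "E \<in> carrier_mat n m"
    unfolding D_def E_def using assms sigma_block_carrier by blast+
  have "(D * E) $$ (i, j) = (if i = j \<and> i < r then of_real ((\<sigma> i)\<^sup>2) else 0)"
    if ij: "i < m" "j < m" for i j
  proof -
    have "(D * E) $$ (i, j) = (D *\<^sub>v col E j) $ i"
      using D E ij by simp
    also have "\<dots> = (if i < r then of_real (\<sigma> i) * E $$ (i, j) else 0)"
      unfolding D_def by (subst sigma_block_mult_vec) (use assms E ij in auto)
    also have "\<dots> = (if i = j \<and> i < r then of_real ((\<sigma> i)\<^sup>2) else 0)"
      unfolding E_def using assms ij by (simp add: sigma_block_index power2_eq_square)
    finally show ?thesis .
  qed
  then have "D * E = mat_diag m (\<lambda>i. of_real (if i < r then (\<sigma> i)\<^sup>2 else 0))"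
    by (intro eq_matI) (use D E in \<open>auto simp: mat_diag_def\<close>)
  then show ?thesis by (simp add: D_def E_def)
qed

text \<open>Here \<open>r\<close> is merely the number of positive generalized eigenvalues; that it
  is the rank follows later from \<open>A W = U D\<close>.\<close>

lemma weighted_svd_columns:
  assumes A: "A \<in> carrier_mat m n" and M: "pos_def_quat_mat m M" and N: "pos_def_quat_mat n N"
  obtains U W r and \<sigma> :: "nat \<Rightarrow> real" where
    "U \<in> carrier_mat m m" "W \<in> carrier_mat n n" "U\<^sup>H * M * U = 1\<^sub>m m" "W\<^sup>H * N * W = 1\<^sub>m n"
    "r \<le> m" "r \<le> n" "A * W = U * sigma_block_mat m n r \<sigma>"
    "\<And>i j. i \<le> j \<Longrightarrow> j < r \<Longrightarrow> \<sigma> j \<le> \<sigma> i" "\<And>i. i < r \<Longrightarrow> 0 < \<sigma> i"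
proof -
  note Mc = pos_def_carrier[OF M] and Nc = pos_def_carrier[OF N]
  define G where "G = A\<^sup>H * (M * A)"
  have Gc: "G \<in> carrier_mat n n"
    unfolding G_def by (rule mult_carrier_mat[of _ _ m]) (use A Mc in auto)
  have "G\<^sup>H = (M * A)\<^sup>H * (A\<^sup>H)\<^sup>H"
    unfolding G_def using A Mc by (intro adjoint_mult[of _ n m]) auto
  also have "\<dots> = A\<^sup>H * M\<^sup>H * A"
    using A Mc by (simp add: adjoint_mult[of _ m m])
  also have "\<dots> = G"
    using A Mc pos_def_hermitian[OF M]
    by (simp add: G_def hermitian_quat_mat_def assoc_mult_mat[of _ n m _ m])
  finally have Gh: "hermitian_quat_mat G"
    by (simp add: hermitian_quat_mat_def)
  have Gv: "cip x (G *\<^sub>v y) = cip (A *\<^sub>v x) (M *\<^sub>v (A *\<^sub>v y))"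
    if "x \<in> carrier_vec n" "y \<in> carrier_vec n" for x y
  proof -
    have "G *\<^sub>v y = A\<^sup>H *\<^sub>v (M *\<^sub>v (A *\<^sub>v y))"
      using A Mc that by (simp add: G_def assoc_mult_mat_vec[of _ n m _ n] assoc_mult_mat_vec[of _ m m _ n])
    then show ?thesis
      using cip_adjoint[OF A that(1)] A Mc that(2) by simp
  qed
  obtain v and s :: "nat \<Rightarrow> real" where v: "orthonormal_family n N n v"
    and Gs: "\<And>i. i < n \<Longrightarrow> G *\<^sub>v v i = (N *\<^sub>v v i) \<cdot>\<^sub>r of_real (s i)"
    using generalized_spectral_family[OF N Gc Gh order_refl] by blast
  obtain p where p: "bij_betw p {..<n} {..<n}" "\<And>i j. i \<le> j \<Longrightarrow> j < n \<Longrightarrow> s (p j) \<le> s (p i)"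
    using ex_antimono_reordering[of n s] by blast
  define w where "w = v \<circ> p"
  define t where "t = s \<circ> p"
  have pn: "p i < n" if "i < n" for i
    using p(1) that by (auto simp: bij_betw_def)
  have pinj: "p i = p j \<longleftrightarrow> i = j" if "i < n" "j < n" for i j
    using p(1) that by (auto simp: bij_betw_def inj_on_def)
  have w: "orthonormal_family n N n w"
    using v pn pinj by (auto simp: orthonormal_family_def w_def)
  have wc: "w i \<in> carrier_vec n" "A *\<^sub>v w i \<in> carrier_vec m" "M *\<^sub>v (A *\<^sub>v w i) \<in> carrier_vec m"
    if "i < n" for i
    using w that A Mc by (auto simp: orthonormal_family_def)
  \<comment> \<open>The images \<open>A w i\<close> are \<open>M\<close>-orthogonal, with squared
    \<open>M\<close>-norms \<open>t i\<close>.\<close>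
  have Aw: "cip (A *\<^sub>v w i) (M *\<^sub>v (A *\<^sub>v w j)) = of_real (if i = j then t i else 0)"
    if ij: "i < n" "j < n" for i j
  proof -
    have "cip (A *\<^sub>v w i) (M *\<^sub>v (A *\<^sub>v w j)) = cip (w i) (G *\<^sub>v w j)"
      using Gv wc ij by simp
    also have "G *\<^sub>v w j = (N *\<^sub>v w j) \<cdot>\<^sub>r of_real (t j)"
      using Gs[OF pn[OF ij(2)]] by (simp add: w_def t_def)
    also have "cip (w i) \<dots> = cip (w i) (N *\<^sub>v w j) * of_real (t j)"
      using Nc wc ij by (intro cip_smult_right[of _ n]) auto
    finally show ?thesis
      using w ij by (simp add: orthonormal_family_def)
  qed
  \<comment> \<open>A nonzero image would have positive squared \<open>M\<close>-norm.\<close>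
  have t0: "A *\<^sub>v w i = 0\<^sub>v m" if i: "i < n" "t i \<le> 0" for i
  proof (rule ccontr)
    assume "A *\<^sub>v w i \<noteq> 0\<^sub>v m"
    then obtain c where "c > 0" "cip (A *\<^sub>v w i) (M *\<^sub>v (A *\<^sub>v w i)) = of_real c"
      using pos_def_cip[OF M wc(2)[OF i(1)]] by blast
    with Aw[OF i(1,1)] i(2) show False by simp
  qed
  \<comment> \<open>The first index with a nonpositive value, or \<open>n\<close> if there is none;
    since \<open>t\<close> decreases, it separates the positive values from the rest.\<close>
  define r where "r = (LEAST i. n \<le> i \<or> t i \<le> 0)"
  have rn: "r \<le> n"
    unfolding r_def by (rule Least_le) simp
  have r_pos: "t i > 0" if "i < r" for i
    using not_less_Least[of i "\<lambda>i. n \<le> i \<or> t i \<le> 0"] that by (simp add: r_def)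
  have r_zero: "A *\<^sub>v w i = 0\<^sub>v m" if "r \<le> i" "i < n" for i
  proof -
    have "n \<le> r \<or> t r \<le> 0"
      unfolding r_def by (rule LeastI[of _ n]) simp
    then have "t i \<le> 0"
      using p(2)[OF that] that by (auto simp: t_def)
    then show ?thesis using t0 that by blast
  qed
  define \<sigma> where "\<sigma> i = sqrt (t i)" for i
  have \<sigma>_pos: "0 < \<sigma> i" if "i < r" for i
    using r_pos[OF that] by (simp add: \<sigma>_def)
  have \<sigma>_mono: "\<sigma> j \<le> \<sigma> i" if "i \<le> j" "j < r" for i j
    using p(2)[of i j] that rn by (simp add: \<sigma>_def t_def)
  define u where "u i = (A *\<^sub>v w i) \<cdot>\<^sub>r of_real (1 / \<sigma> i)" for i
  have u: "orthonormal_family m M r u"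
    unfolding orthonormal_family_def
  proof (intro conjI allI impI)
    fix i assume "i < r"
    then show "u i \<in> carrier_vec m"
      using wc rn by (simp add: u_def)
    fix j assume "j < r"
    with \<open>i < r\<close> have ij: "i < n" "j < n" using rn by auto
    have "M *\<^sub>v u j = (M *\<^sub>v (A *\<^sub>v w j)) \<cdot>\<^sub>r of_real (1 / \<sigma> j)"
      unfolding u_def by (rule mult_mat_vec_smult_right[OF Mc wc(2)[OF ij(2)]])
    then have "cip (u i) (M *\<^sub>v u j)
        = of_real (1 / \<sigma> i) * (of_real (if i = j then t i else 0) * of_real (1 / \<sigma> j))"
      using wc ij by (simp add: u_def cip_smult_left[of _ m] cip_smult_right[of _ m] Aw mult.assoc
          del: of_real_divide)
    also have "\<dots> = of_real (1 / \<sigma> i * ((if i = j then t i else 0) * (1 / \<sigma> j)))"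
      by (simp only: of_real_mult)
    also have "1 / \<sigma> i * ((if i = j then t i else 0) * (1 / \<sigma> j)) = of_bool (i = j)"
      using r_pos[OF \<open>i < r\<close>] by (auto simp: \<sigma>_def field_simps)
    finally show "cip (u i) (M *\<^sub>v u j) = of_bool (i = j)" by simp
  qed
  \<comment> \<open>The bound by \<open>m\<close> comes from having \<open>r\<close> orthonormal
    vectors in dimension \<open>m\<close>.\<close>
  have rm: "r \<le> m"
    using orthonormal_family_card_le[OF Mc u] .
  obtain u' where u': "orthonormal_family m M m u'" "\<And>i. i < r \<Longrightarrow> u' i = u i"
    using orthonormal_family_extend[OF M u rm] by blast
  let ?U = "frame_mat m m u'" and ?W = "frame_mat n n w"
  have "A * ?W = ?U * sigma_block_mat m n r \<sigma>"
  proof (rule eq_matI)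
    fix i j
    assume "i < dim_row (?U * sigma_block_mat m n r \<sigma>)" "j < dim_col (?U * sigma_block_mat m n r \<sigma>)"
    then have ij: "i < m" "j < n"
      using carrier_matD[OF sigma_block_carrier[OF rm rn, of \<sigma>]] by auto
    have "(A * ?W) $$ (i, j) = (A *\<^sub>v w j) $ i"
      using A ij wc by simp
    \<comment> \<open>For \<open>j < r\<close>, column \<open>j\<close> of the frame is the
      normalized image, which \<open>\<sigma> j\<close> scales back; for the remaining
      \<open>j\<close> the image is zero.\<close>
    also have "\<dots> = (if j < r then ?U $$ (i, j) * of_real (\<sigma> j) else 0)"
    proof (cases "j < r")
      case True
      then have "?U $$ (i, j) = (A *\<^sub>v w j) $ i * of_real (1 / \<sigma> j)"
        using ij u'(2) wc rm A by (simp add: frame_mat_def u_def del: of_real_divide index_mult_mat_vec)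
      moreover have "of_real (1 / \<sigma> j) * of_real (\<sigma> j) = (1 :: quat)"
        using \<sigma>_pos[OF True] by (simp only: flip: of_real_mult) simp
      ultimately show ?thesis
        using True by (simp only: mult.assoc mult_1_right if_True)
    next
      case False
      then show ?thesis using r_zero[of j] ij by simp
    qed
    also have "\<dots> = (?U * sigma_block_mat m n r \<sigma>) $$ (i, j)"
      using ij rm rn by (simp add: sigma_block_right_mult_index del: index_mult_mat)
    finally show "(A * ?W) $$ (i, j) = (?U * sigma_block_mat m n r \<sigma>) $$ (i, j)" .
  qed (simp_all only: index_mult_mat frame_mat_dims carrier_matD[OF A]
      carrier_matD[OF sigma_block_carrier[OF rm rn, of \<sigma>]])
  moreover have "?U\<^sup>H * M * ?U = 1\<^sub>m m" "?W\<^sup>H * N * ?W = 1\<^sub>m n"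
    using frame_mat_orthonormal Mc Nc u'(1) w by blast+
  ultimately show ?thesis
    using that[of ?U ?W r \<sigma>] rm rn \<sigma>_pos \<sigma>_mono by simp
qed

section \<open>Assembly of the decomposition and of both eigenvalue lists\<close>

theorem theorem3p1:
  fixes A M N :: "quat mat" and m n r :: nat
  assumes "A \<in> carrier_mat m n"
    and "rank_quat_mat A = r"
    and "pos_def_quat_mat m M"
    and "pos_def_quat_mat n N"
  shows "\<exists>U V (\<sigma> :: nat \<Rightarrow> real).
    U \<in> carrier_mat m m \<and> V \<in> carrier_mat n n \<and>
    U\<^sup>H * M * U = 1\<^sub>m m \<and>
    V\<^sup>H * inv_quat_mat N * V = 1\<^sub>m n \<and>
    A = U * sigma_block_mat m n r \<sigma> * V\<^sup>H \<and>
    (\<forall>i j. i \<le> j \<and> j < r \<longrightarrow> \<sigma> j \<le> \<sigma> i) \<and>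
    (\<forall>i<r. 0 < \<sigma> i) \<and>
    lists_nonzero_eigenvalues (weighted_adjoint M N A * A) r (\<lambda>i. (\<sigma> i)\<^sup>2) \<and>
    lists_nonzero_eigenvalues (A * weighted_adjoint M N A) r (\<lambda>i. (\<sigma> i)\<^sup>2)"
proof -
  note A = assms(1)
  note M = pos_def_carrier[OF assms(3)] and N = pos_def_carrier[OF assms(4)]
  obtain U W q and \<sigma> :: "nat \<Rightarrow> real" where U: "U \<in> carrier_mat m m" and W: "W \<in> carrier_mat n n"
    and UMU: "U\<^sup>H * M * U = 1\<^sub>m m" and WNW: "W\<^sup>H * N * W = 1\<^sub>m n"
    and q: "q \<le> m" "q \<le> n" and AW: "A * W = U * sigma_block_mat m n q \<sigma>"
    and mono: "\<And>i j. i \<le> j \<Longrightarrow> j < q \<Longrightarrow> \<sigma> j \<le> \<sigma> i" and pos: "\<And>i. i < q \<Longrightarrow> 0 < \<sigma> i"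
    using weighted_svd_columns[OF A assms(3,4)] by blast
  define D where "D = sigma_block_mat m n q \<sigma>"
  have D: "D \<in> carrier_mat m n"
    unfolding D_def using q by (rule sigma_block_carrier)
  have AW: "A * W = U * D" using AW by (simp add: D_def)
  define U' where "U' = U\<^sup>H * M"
  define W' where "W' = W\<^sup>H * N"
  have U': "U' \<in> carrier_mat m m" "U' * U = 1\<^sub>m m"
    using U M UMU by (auto simp: U'_def intro!: mult_carrier_mat[of _ m m])
  have W': "W' \<in> carrier_mat n n" "W' * W = 1\<^sub>m n" "W * W' = 1\<^sub>m n"
  proof -
    show 1: "W' \<in> carrier_mat n n"
      using W N by (auto simp: W'_def intro!: mult_carrier_mat[of _ n n])
    show 2: "W' * W = 1\<^sub>m n" using WNW by (simp add: W'_def)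
    show "W * W' = 1\<^sub>m n" using quat_mat_mult_left_right_inverse[OF 1 W 2] .
  qed
  \<comment> \<open>The size \<open>q\<close> of the block is identified with the given
    rank.\<close>
  have "rank_quat_mat A = q"
    using rank_quat_mat_eqI[OF A U U'(1) W W'(1) U'(2) W'(3) q _ AW[unfolded D_def]] pos by force
  then have r: "q = r" using assms(2) by simp
  have WWc: "W * W\<^sup>H \<in> carrier_mat n n"
    using W by (auto intro!: mult_carrier_mat[of _ n n])
  have Ninv: "inv_quat_mat N = W * W\<^sup>H"
    using inv_quat_mat_eq[OF N WWc] orthonormal_frame_inverse(1)[OF N W WNW] by blast
  \<comment> \<open>This choice makes \<open>V^H = W^H N = W'\<close>, the inverse of
    \<open>W\<close>, so \<open>A W = U D\<close> becomes \<open>A = U D V^H\<close>.\<close>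
  define V where "V = N * W"
  have V: "V \<in> carrier_mat n n" using N W by (simp add: V_def)
  have VH: "V\<^sup>H = W'"
    using pos_def_hermitian[OF assms(4)] adjoint_mult[OF N W]
    by (simp add: V_def W'_def hermitian_quat_mat_def)
  have "V\<^sup>H * inv_quat_mat N * V = 1\<^sub>m n"
  proof -
    have "V\<^sup>H * inv_quat_mat N * V = (W' * W) * W\<^sup>H * V"
      unfolding VH Ninv using assoc_mult_mat[OF W'(1) W adjoint_carrier[OF W]] by simp
    also have "\<dots> = W\<^sup>H * V"
      using W adjoint_carrier[OF W] by (simp add: W'(2))
    also have "W\<^sup>H * V = 1\<^sub>m n"
      using WNW W N by (simp add: V_def assoc_mult_mat[of _ n n _ n _ n])
    finally show ?thesis .
  qed
  moreover have "A = U * D * V\<^sup>H"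
  proof -
    have "A = A * (W * W')" using A W' by simp
    also have "\<dots> = A * W * W'"
      using A W W' by (simp add: assoc_mult_mat[of _ m n _ n _ n])
    finally show ?thesis by (simp add: AW VH)
  qed
  moreover have lists: "lists_nonzero_eigenvalues (weighted_adjoint M N A * A) r (\<lambda>i. (\<sigma> i)\<^sup>2)"
    "lists_nonzero_eigenvalues (A * weighted_adjoint M N A) r (\<lambda>i. (\<sigma> i)\<^sup>2)"
  proof -
    define S where "S = weighted_adjoint M N A"
    have DH: "D\<^sup>H \<in> carrier_mat n m" using D by simp
    have WH: "W\<^sup>H \<in> carrier_mat n n" and AH: "A\<^sup>H \<in> carrier_mat n m" and UH: "U\<^sup>H \<in> carrier_mat m m"
      using A W U by simp_all
    have WA: "W\<^sup>H * A\<^sup>H = D\<^sup>H * U\<^sup>H"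
      using adjoint_mult[OF A W] adjoint_mult[OF U D] AW by simp
    \<comment> \<open>Taking adjoints in \<open>A W = U D\<close> gives the decomposition of the
      weighted adjoint, with \<open>U'\<close> as the inverse of \<open>U\<close>.\<close>
    have S_eq: "S = W * (D\<^sup>H * U')"
    proof -
      have "S = W * (W\<^sup>H * A\<^sup>H) * M"
        unfolding S_def weighted_adjoint_def Ninv
        using assoc_mult_mat[OF W WH AH] by simp
      also have "\<dots> = W * (D\<^sup>H * U\<^sup>H * M)"
        unfolding WA
        by (rule assoc_mult_mat[OF W mult_carrier_mat[OF DH UH] M])
      also have "D\<^sup>H * U\<^sup>H * M = D\<^sup>H * U'"
        unfolding U'_def by (rule assoc_mult_mat[OF DH UH M])
      finally show ?thesis .
    qed
    have DU': "D\<^sup>H * U' \<in> carrier_mat n m"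
      using DH U'(1) by (rule mult_carrier_mat)
    have Sc: "S \<in> carrier_mat n m"
      unfolding S_eq using W DU' by (rule mult_carrier_mat)
    have SU: "S * U = W * D\<^sup>H"
    proof -
      have "S * U = W * (D\<^sup>H * U' * U)"
        unfolding S_eq by (rule assoc_mult_mat[OF W DU' U])
      also have "D\<^sup>H * U' * U = D\<^sup>H"
        using assoc_mult_mat[OF DH U'(1) U] U'(2) right_mult_one_mat[OF DH] by simp
      finally show ?thesis .
    qed
    \<comment> \<open>\<open>A\<close> maps the frame \<open>W\<close> to \<open>U D\<close> and
      \<open>S\<close> maps \<open>U\<close> back to \<open>W D^H\<close>, so \<open>W\<close>
      diagonalizes \<open>S A\<close>; the same two relations make \<open>U\<close> diagonalize
      \<open>A S\<close>.\<close>
    have "S * A * W = W * (D\<^sup>H * D)"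
    proof -
      have "S * A * W = S * (U * D)"
        using assoc_mult_mat[OF Sc A W] AW by simp
      also have "\<dots> = W * D\<^sup>H * D"
        using assoc_mult_mat[OF Sc U D] SU by simp
      also have "\<dots> = W * (D\<^sup>H * D)"
        by (rule assoc_mult_mat[OF W DH D])
      finally show ?thesis .
    qed
    then have "S * A * W = W * mat_diag n (\<lambda>i. of_real (if i < r then (\<sigma> i)\<^sup>2 else 0))"
      using sigma_block_mult_sigma_block[OF q(2,1)] adjoint_sigma_block[OF q] by (simp add: D_def r)
    then show "lists_nonzero_eigenvalues (weighted_adjoint M N A * A) r (\<lambda>i. (\<sigma> i)\<^sup>2)"
      unfolding S_def[symmetric]
      using lists_nonzero_eigenvalues_diag[OF mult_carrier_mat[OF Sc A] W W'(1,2)] pos q r by force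
    have "A * S * U = U * (D * D\<^sup>H)"
    proof -
      have "A * S * U = A * (W * D\<^sup>H)"
        using assoc_mult_mat[OF A Sc U] SU by simp
      also have "\<dots> = U * D * D\<^sup>H"
        using assoc_mult_mat[OF A W DH] AW by simp
      also have "\<dots> = U * (D * D\<^sup>H)"
        by (rule assoc_mult_mat[OF U D DH])
      finally show ?thesis .
    qed
    then have "A * S * U = U * mat_diag m (\<lambda>i. of_real (if i < r then (\<sigma> i)\<^sup>2 else 0))"
      using sigma_block_mult_sigma_block[OF q] adjoint_sigma_block[OF q] by (simp add: D_def r)
    then show "lists_nonzero_eigenvalues (A * weighted_adjoint M N A) r (\<lambda>i. (\<sigma> i)\<^sup>2)"
      unfolding S_def[symmetric]
      using lists_nonzero_eigenvalues_diag[OF mult_carrier_mat[OF A Sc] U U'] pos q r by force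
  qed
  ultimately show ?thesis
    using U V UMU mono pos unfolding D_def r by blast
qed

end
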